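(* Let $P(x_1,\dots,x_d)=\sum_{\alpha\in\Lambda}C_\alpha x^\alpha$, with $x^\alpha=\prod_{j=1}^d x_j^{\alpha_j}$, be a multivariate polynomial in $d$ variables, where $\Lambda\subset\mathbb{N}^d$ is the (non-empty) set of multi-indices associated with its non-zero coefficients. Suppose that $\Phi=\{1,\mathrm{Id}\}$. Let $q\ge 2$ be the number of workspace slots and $p=d+2+q$. Then there exist a lift $\mathfrak{L}:\mathbb{R}^d\to\mathbb{R}^p$ and a retraction $\mathfrak{R}:\mathbb{R}^p\to\mathbb{R}$, respectively defined by $$\mathfrak{L}(x)=(0,x_1,\dots,x_d,0,\dots,0),\qquad \mathfrak{R}(y)=y_1,$$ and $L$ functions $\psi_1,\dots,\psi_L$ in tensor-train (TT) format such that $$P=\mathfrak{R}\circ(\mathrm{Id}+\psi_L)\circ\dots\circ(\mathrm{Id}+\psi_1)\circ\mathfrak{L},$$ with $$L=|\Lambda|(2+d)+\sum_{\alpha\in\Lambda}\sum_{j=1}^d\lfloor\log_q(\alpha_j+1)\rfloor=\mathcal{O}\big(d|\Lambda|\lfloor\log_q(N_{\max}+1)\rfloor\big),$$ where $N_{\max}:=\max_j N_j$ and $N_j:=\max\{\alpha_j:\alpha\in\Lambda\}$ for $j=1,\dots,d$. Moreover, the number of non-zero parameters in the encoding is $\mathcal{O}(|\Lambda|d[1+\lfloor\log_q(N_{\max}+1)\rfloor])$ and the number of parameters is $\mathcal{O}(L(d+q))$. The TT ranks of the functions $\psi_\ell$ are bounded by $\boldsymbol r=(p,2,\dots,2)$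.
   Context: The multi-indices in $\Lambda$ have non-negative integer entries, and $q$ is an integer. The functions $\psi_\ell:\mathbb{R}^p\to\mathbb{R}^p$ are functional tensors with univariate basis $\Phi=\{\phi_1,\dots,\phi_n\}$ (here $n=2$, the constant function $1$ and the identity function on $\mathbb{R}$): each has a coefficient tensor $\boldsymbol\psi_\ell\in\mathbb{R}^{p\times n\times\dots\times n}$ such that $\psi_\ell(x)_j=\sum_{i_1,\dots,i_p}\boldsymbol\psi_\ell(j,i_1,\dots,i_p)\,\phi_{i_1}(x_1)\cdots\phi_{i_p}(x_p)$ for $1\le j\le p$. Such a function is in TT format with ranks $(r_0,r_1,\dots,r_{p-1})$, where $r_0=p$ is the output dimension and $r_p=1$, if $\psi_\ell(x)=U_1(x_1)U_2(x_2)\cdots U_p(x_p)$ with matrix-valued functions $U_i:\mathbb{R}\to\mathbb{R}^{r_{i-1}\times r_i}$ whose entries lie in $\operatorname{span}\Phi$. The TT ranks of a function are the elementwise smallest ranks for which such a representation exists. $\mathrm{Id}+\psi_\ell$ denotes the map $y\mapsto y+\psi_\ell(y)$ on $\mathbb{R}^p$; the integer $L$ is the number of layers of the encoding.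
   Formalization: The bound L = O(d|Λ|⌊log_q(N_max+1)⌋) is stated only when ⌊log_q(N_max+1)⌋ ≥ 1 (otherwise it reads L ≤ 0), and the constant in the bound on the non-zero parameters may depend on q (for P(x)=x each of the q+3 cores of some layer has a non-zero entry); d ≥ 1. *)

theory Defs
  imports Complex_Main "HOL-Library.FuncSet" "Jordan_Normal_Form.Matrix"
begin

text \<open>
  Elements of \<open>\<real>\<^sup>m\<close> are real vectors in \<^term>\<open>carrier_vec m\<close>, multi-indices in \<open>\<nat>\<^sup>d\<close> are
  natural-number vectors in \<^term>\<open>carrier_vec d\<close>. All indices start at 0, so the mathematical
  indices 1, ..., m become 0, ..., m - 1 (ranks keep their indices 0, ..., p).
  A univariate basis is a list of functions.
\<close>

section \<open>Functional tensors and the tensor-train format\<close>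

definition affine_basis :: "(real \<Rightarrow> real) list" where
  "affine_basis = [\<lambda>_. 1, \<lambda>t. t]"

definition functional_tensor ::
  "(real \<Rightarrow> real) list \<Rightarrow> nat \<Rightarrow> (real vec \<Rightarrow> real vec) \<Rightarrow> bool" where
  "functional_tensor \<Phi> p f \<longleftrightarrow>
     (\<exists>c :: nat \<Rightarrow> (nat \<Rightarrow> nat) \<Rightarrow> real. \<forall>y \<in> carrier_vec p.
        f y \<in> carrier_vec p \<and>
        (\<forall>j<p. f y $ j =
           (\<Sum>i \<in> {..<p} \<rightarrow>\<^sub>E {..<length \<Phi>}. c j i * (\<Prod>m<p. (\<Phi> ! i m) (y $ m)))))"

text \<open>
  A core, i.e. a matrix-valued function with entries in the span of the basis, is given by its
  list of coefficient matrices, one for each basis function. The entries of these matrices are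
  the parameters of the format.
\<close>

type_synonym tt_core = "real mat list"
type_synonym tt_cores = "tt_core list"

definition core_eval :: "(real \<Rightarrow> real) list \<Rightarrow> tt_core \<Rightarrow> real \<Rightarrow> real mat" where
  "core_eval \<Phi> G t =
     mat (dim_row (G ! 0)) (dim_col (G ! 0))
       (\<lambda>(a, b). \<Sum>k<length \<Phi>. (\<Phi> ! k) t * (G ! k) $$ (a, b))"

text \<open>
  The product \<open>U\<^sub>1(y\<^sub>1) \<cdots> U\<^sub>p(y\<^sub>p)\<close> is a matrix with a single column, which is read as a vector.
\<close>

definition tt_eval :: "(real \<Rightarrow> real) list \<Rightarrow> tt_cores \<Rightarrow> real vec \<Rightarrow> real vec" where
  "tt_eval \<Phi> U y =
     col (foldr (*) (map (\<lambda>i. core_eval \<Phi> (U ! i) (y $ i)) [0..<length U]) (1\<^sub>m 1)) 0"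

definition tt_cores_with_ranks ::
  "(real \<Rightarrow> real) list \<Rightarrow> nat \<Rightarrow> (nat \<Rightarrow> nat) \<Rightarrow> tt_cores \<Rightarrow> bool" where
  "tt_cores_with_ranks \<Phi> p r U \<longleftrightarrow>
     r 0 = p \<and> r p = 1 \<and> (\<forall>i\<le>p. 1 \<le> r i) \<and> length U = p \<and>
     (\<forall>i<p. length (U ! i) = length \<Phi> \<and>
        (\<forall>k<length \<Phi>. U ! i ! k \<in> carrier_mat (r i) (r (Suc i))))"

definition tt_represents ::
  "(real \<Rightarrow> real) list \<Rightarrow> nat \<Rightarrow> (nat \<Rightarrow> nat) \<Rightarrow> tt_cores \<Rightarrow> (real vec \<Rightarrow> real vec) \<Rightarrow> bool" where
  "tt_represents \<Phi> p r U f \<longleftrightarrow>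
     functional_tensor \<Phi> p f \<and> tt_cores_with_ranks \<Phi> p r U \<and>
     (\<forall>y \<in> carrier_vec p. f y = tt_eval \<Phi> U y)"

text \<open>
  The \<open>k\<close>-th entry (\<open>k < p\<close>) of the elementwise smallest ranks. The value is meaningful only
  if some representation exists.
\<close>

definition tt_rank :: "(real \<Rightarrow> real) list \<Rightarrow> nat \<Rightarrow> (real vec \<Rightarrow> real vec) \<Rightarrow> nat \<Rightarrow> nat" where
  "tt_rank \<Phi> p f k = (LEAST m. \<exists>r U. tt_represents \<Phi> p r U f \<and> r k = m)"

definition num_params :: "tt_cores \<Rightarrow> nat" where
  "num_params U = (\<Sum>G\<leftarrow>U. \<Sum>A\<leftarrow>G. dim_row A * dim_col A)"

definition num_nonzero_params :: "tt_cores \<Rightarrow> nat" where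
  "num_nonzero_params U =
     (\<Sum>G\<leftarrow>U. \<Sum>A\<leftarrow>G. card {(a, b). a < dim_row A \<and> b < dim_col A \<and> A $$ (a, b) \<noteq> 0})"

section \<open>Lift, retraction and layers\<close>

definition lift :: "nat \<Rightarrow> nat \<Rightarrow> real vec \<Rightarrow> real vec" where
  "lift d p x = vec p (\<lambda>i. if 1 \<le> i \<and> i \<le> d then x $ (i - 1) else 0)"

definition retraction :: "real vec \<Rightarrow> real" where
  "retraction y = y $ 0"

text \<open>\<open>(Id + \<psi>\<^sub>L) \<circ> \<cdots> \<circ> (Id + \<psi>\<^sub>1)\<close> for the list \<open>[\<psi>\<^sub>1, \<dots>, \<psi>\<^sub>L]\<close>: the head acts first.\<close>

definition residual_layers :: "(real vec \<Rightarrow> real vec) list \<Rightarrow> real vec \<Rightarrow> real vec" where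
  "residual_layers \<psi>s = fold (\<lambda>\<psi> y. y + \<psi> y) \<psi>s"

section \<open>Polynomials and their exponents\<close>

definition poly_fun :: "nat \<Rightarrow> nat vec set \<Rightarrow> (nat vec \<Rightarrow> real) \<Rightarrow> real vec \<Rightarrow> real" where
  "poly_fun d \<Lambda> C x = (\<Sum>\<alpha>\<in>\<Lambda>. C \<alpha> * (\<Prod>j<d. (x $ j) ^ (\<alpha> $ j)))"

definition max_exponent_in :: "nat vec set \<Rightarrow> nat \<Rightarrow> nat" where
  "max_exponent_in \<Lambda> j = Max ((\<lambda>\<alpha>. \<alpha> $ j) ` \<Lambda>)"

definition max_exponent :: "nat \<Rightarrow> nat vec set \<Rightarrow> nat" where
  "max_exponent d \<Lambda> = Max (max_exponent_in \<Lambda> ` {..<d})"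

text \<open>Only used for \<open>n \<ge> 1\<close> and \<open>q \<ge> 2\<close>, where the floor is non-negative.\<close>

definition floor_log :: "nat \<Rightarrow> nat \<Rightarrow> nat" where
  "floor_log q n = nat \<lfloor>log (real q) (real n)\<rfloor>"

definition num_layers :: "nat \<Rightarrow> nat \<Rightarrow> nat vec set \<Rightarrow> nat" where
  "num_layers q d \<Lambda> = card \<Lambda> * (2 + d) + (\<Sum>\<alpha>\<in>\<Lambda>. \<Sum>j<d. floor_log q (\<alpha> $ j + 1))"

end

theory Submission
  imports Defs
begin

text \<open>
  A layer that adds two monomials, with coefficient vectors that are affine in the first
  coordinate, has TT ranks \<open>(p, 2, \<dots>, 2)\<close>, with diagonal inner cores. All layers below are of this
  kind; the layers that are not needed are zero and have no non-zero parameters.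

  A monomial \<open>x\<^sup>\<alpha>\<close> is computed by Horner's rule in a mixed radix, for all variables at once: from
  \<open>A = \<Prod> x\<^sub>j ^ (\<alpha>\<^sub>j div (r R))\<close> one passes to \<open>A ^ r \<Prod> x\<^sub>j ^ (digit of \<alpha>\<^sub>j) = \<Prod> x\<^sub>j ^ (\<alpha>\<^sub>j div R)\<close>. If \<open>\<alpha>\<^sub>j\<close> has
  at most \<open>D\<^sub>j\<close> digits in base \<open>q\<close> and \<open>N\<^sub>k\<close> is the number of variables with \<open>D\<^sub>j > k\<close>, then \<open>2 + \<Sum> D\<^sub>j\<close>
  layers are available, that is, \<open>N\<^sub>k\<close> for the base-\<open>q\<close> level \<open>k\<close> and two more.
  If \<open>N\<^sub>k = 1\<close>, one layer suffices: the first coordinate holds a copy \<open>B\<close> of that variable, so the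
  coefficients can place \<open>A\<close> and \<open>A B\<close> in any proportion in the \<open>q\<close> slots whose product is taken
  next. If \<open>2 ^ N\<^sub>k \<ge> q\<close>, the level is replaced by at most \<open>N\<^sub>k\<close> binary digits. The levels in between
  use two layers with radix about \<open>\<surd>q\<close> and tables of copies of the variables; if loading and
  erasing these tables is too expensive, then all these \<open>N\<^sub>k\<close> are even, and the slots hold products
  of \<open>A\<close> with nested products of variables instead, whose remains are erased two at a time.
\<close>

section \<open>Layers that add two monomials\<close>

type_synonym upd = "nat set \<times> (nat \<Rightarrow> real) \<times> (nat \<Rightarrow> real)"
type_synonym layer = "upd \<times> upd"

fun upd_val :: "upd \<Rightarrow> (nat \<Rightarrow> real) \<Rightarrow> nat \<Rightarrow> real" where
  "upd_val (S, c, c') f j = (c j + c' j * f 0) * prod f S"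

fun upd_within :: "nat \<Rightarrow> upd \<Rightarrow> bool" where
  "upd_within p (S, c, c') \<longleftrightarrow> S \<subseteq> {1..<p}"

definition layer_within :: "nat \<Rightarrow> layer \<Rightarrow> bool" where
  "layer_within p l \<longleftrightarrow> upd_within p (fst l) \<and> upd_within p (snd l)"

definition run_layer :: "layer \<Rightarrow> (nat \<Rightarrow> real) \<Rightarrow> nat \<Rightarrow> real" where
  "run_layer l f j = f j + upd_val (fst l) f j + upd_val (snd l) f j"

definition run :: "layer list \<Rightarrow> (nat \<Rightarrow> real) \<Rightarrow> nat \<Rightarrow> real" where
  "run ls f = fold run_layer ls f"

definition layer_map :: "nat \<Rightarrow> layer \<Rightarrow> real vec \<Rightarrow> real vec" where
  "layer_map p l y = vec p (\<lambda>j. upd_val (fst l) (($) y) j + upd_val (snd l) (($) y) j)"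

lemma run_Nil [simp]: "run [] f = f"
  and run_Cons [simp]: "run (l # ls) f = run ls (run_layer l f)"
  and run_append [simp]: "run (ks @ ls) f = run ls (run ks f)"
  by (simp_all add: run_def)

text \<open>Entries of \<open>vec p f\<close> from \<open>p\<close> on are unspecified, so an update
  may read only entries below \<open>p\<close>; \<open>p > 0\<close> covers entry 0, which the
  affine coefficients read.\<close>

lemma upd_val_vec:
  assumes "upd_within p u" "p > 0"
  shows "upd_val u (($) (vec p f)) j = upd_val u f j"
proof -
  obtain S c c' where u: "u = (S, c, c')" by (cases u) auto
  have "prod (($) (vec p f)) S = prod f S"
    using assms u by (intro prod.cong) auto
  then show ?thesis using assms u by simp
qed

lemma residual_layers_run:
  assumes "\<forall>l\<in>set ls. layer_within p l" "p > 0"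
  shows "residual_layers (map (layer_map p) ls) (vec p f) = vec p (run ls f)"
  using assms(1)
proof (induction ls arbitrary: f)
  case Nil
  then show ?case by (simp add: residual_layers_def)
next
  case (Cons l ls)
  then have l: "layer_within p l" by simp
  have "vec p f + layer_map p l (vec p f) = vec p (run_layer l f)"
    by (rule eq_vecI)
      (use l \<open>p > 0\<close> in \<open>auto simp: layer_map_def run_layer_def layer_within_def upd_val_vec\<close>)
  with Cons show ?case by (simp add: residual_layers_def)
qed

section \<open>Tensor-train format of a layer\<close>

definition layer_ranks :: "nat \<Rightarrow> nat \<Rightarrow> nat" where
  "layer_ranks p k = (if k = 0 then p else if k = p then 1 else 2)"

definition branch :: "layer \<Rightarrow> nat \<Rightarrow> upd" where
  "branch l a = (if a = 0 then fst l else snd l)"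

text \<open>The bond index \<open>a\<close> selects one of the two updates. Core 0 carries the
  coefficients, affine in \<open>y $ 0\<close>; core \<open>i\<close> multiplies branch
  \<open>a\<close> by \<open>y $ i\<close> or by 1, and the last core is a column, which sums the
  branches. The values False and True stand for the basis functions 1 and Id.\<close>

definition layer_core :: "nat \<Rightarrow> layer \<Rightarrow> nat \<Rightarrow> tt_core" where
  "layer_core p l i =
     (if i = 0 then [mat p 2 (\<lambda>(j, a). fst (snd (branch l a)) j), mat p 2 (\<lambda>(j, a). snd (snd (branch l a)) j)]
      else map (\<lambda>linear. mat 2 (layer_ranks p (Suc i)) (\<lambda>(a, b).
             of_bool ((Suc i = p \<or> a = b) \<and> (linear \<longleftrightarrow> i \<in> fst (branch l a))))) [False, True])"

definition layer_cores :: "nat \<Rightarrow> layer \<Rightarrow> tt_cores" where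
  "layer_cores p l = map (layer_core p l) [0..<p]"

lemma length_affine_basis [simp]: "length affine_basis = 2"
  by (simp add: affine_basis_def)

lemma all_less_2: "(\<forall>k<2. P k) \<longleftrightarrow> P 0 \<and> P (Suc 0)"
  by (auto simp: less_2_cases_iff)

lemma lessThan_2: "{..<2} = {0, Suc 0}"
  by auto

lemma cores_with_ranks:
  assumes "p \<ge> 2"
  shows "tt_cores_with_ranks affine_basis p (layer_ranks p) (layer_cores p l)"
  using assms
  by (auto simp: tt_cores_with_ranks_def layer_cores_def layer_core_def layer_ranks_def all_less_2)

lemma layer_core_eval:
  assumes "i > 0"
  shows "core_eval affine_basis (layer_core p l i) t =
    mat 2 (layer_ranks p (Suc i)) (\<lambda>(a, b). if Suc i = p \<or> a = b then (if i \<in> fst (branch l a) then t else 1) else 0)"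
  using assms
  by (intro eq_matI) (auto simp: core_eval_def layer_core_def affine_basis_def lessThan_2)

lemma layer_core_eval_0:
  "core_eval affine_basis (layer_core p l 0) t =
    mat p 2 (\<lambda>(j, a). fst (snd (branch l a)) j + snd (snd (branch l a)) j * t)"
  by (intro eq_matI) (auto simp: core_eval_def layer_core_def affine_basis_def lessThan_2)

text \<open>Diagonal cores never mix the two branches, so the cores from \<open>k\<close> on
  multiply to a column of two independent products. The induction is on the number of cores after
  \<open>k\<close>.\<close>

lemma layer_cores_tail:
  assumes "0 < k" "k < p"
  shows "foldr (*) (map (\<lambda>i. core_eval affine_basis (layer_core p l i) (y $ i)) [k..<p]) (1\<^sub>m 1) =
    mat 2 1 (\<lambda>(a, _). \<Prod>i\<in>{k..<p}. if i \<in> fst (branch l a) then y $ i else 1)"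
  using assms
proof (induction "p - Suc k" arbitrary: k)
  case 0
  then have k: "Suc k = p" by simp
  then have "[k..<p] = [k]" "{k..<p} = {k}" by (auto simp flip: k)
  with 0 k show ?case
    by (intro eq_matI) (auto simp: layer_core_eval layer_ranks_def)
next
  case (Suc n)
  then have k: "[k..<p] = k # [Suc k..<p]" by (simp add: upt_conv_Cons)
  have fin: "{k..<p} = insert k {Suc k..<p}" using Suc.prems by auto
  have IH: "foldr (*) (map (\<lambda>i. core_eval affine_basis (layer_core p l i) (y $ i)) [Suc k..<p]) (1\<^sub>m 1) =
    mat 2 1 (\<lambda>(a, _). \<Prod>i\<in>{Suc k..<p}. if i \<in> fst (branch l a) then y $ i else 1)"
    using Suc by (intro Suc.hyps(1)) auto
  have "Suc k \<noteq> p" using Suc by auto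
  then show ?case unfolding k
    using Suc.prems
    by (intro eq_matI)
      (auto simp: IH layer_core_eval layer_ranks_def scalar_prod_def fin lessThan_2 less_2_cases_iff
        atLeast0LessThan simp del: One_nat_def)
qed

lemma prod_if_subset:
  fixes f :: "nat \<Rightarrow> real"
  assumes "S \<subseteq> A" "finite A"
  shows "(\<Prod>i\<in>A. if i \<in> S then f i else 1) = prod f S"
  using assms by (simp add: prod.If_cases Int_absorb1)

lemma tt_eval_layer_cores:
  assumes "p \<ge> 2" "layer_within p l" "y \<in> carrier_vec p"
  shows "tt_eval affine_basis (layer_cores p l) y = layer_map p l y"
proof -
  let ?P = "\<lambda>a. prod (($) y) (fst (branch l a))"
  have sub: "fst (branch l a) \<subseteq> {1..<p}" for a
    using assms(2) by (cases l; cases "fst l"; cases "snd l") (auto simp: layer_within_def branch_def)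
  have "map (\<lambda>i. core_eval affine_basis (layer_cores p l ! i) (y $ i)) [0..<length (layer_cores p l)]
      = map (\<lambda>i. core_eval affine_basis (layer_core p l i) (y $ i)) [0..<p]"
    by (auto simp: layer_cores_def)
  also have "\<dots> = core_eval affine_basis (layer_core p l 0) (y $ 0) #
      map (\<lambda>i. core_eval affine_basis (layer_core p l i) (y $ i)) [1..<p]"
    using assms(1) by (simp add: upt_conv_Cons)
  finally have "tt_eval affine_basis (layer_cores p l) y =
      col (mat p 2 (\<lambda>(j, a). fst (snd (branch l a)) j + snd (snd (branch l a)) j * y $ 0) *
           mat 2 1 (\<lambda>(a, _). ?P a)) 0"
    using assms(1) sub
    by (simp add: tt_eval_def layer_cores_tail layer_core_eval_0 prod_if_subset del: One_nat_def)
  also have "\<dots> = layer_map p l y"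
    by (rule eq_vecI, cases "fst l", cases "snd l")
      (auto simp: layer_map_def scalar_prod_def branch_def lessThan_2 atLeast0LessThan)
  finally show ?thesis .
qed

text \<open>A monomial without squares needs a single tensor entry, located at the indicator
  function of \<open>S\<close>: index 1 stands for Id, index 0 for the constant.\<close>

lemma functional_tensor_monomial:
  assumes "S \<subseteq> {..<p}"
  shows "(\<Sum>i \<in> {..<p} \<rightarrow>\<^sub>E {..<2}. (if i = (\<lambda>m\<in>{..<p}. of_bool (m \<in> S)) then a else 0) *
      (\<Prod>m<p. (affine_basis ! i m) (y $ m))) = a * prod (($) y) S"
    (is "(\<Sum>i\<in>?A. (if i = ?i0 then a else 0) * ?F i) = _")
proof -
  have mem: "?i0 \<in> ?A" by auto
  have "(\<Sum>i\<in>?A. (if i = ?i0 then a else 0) * ?F i) = (\<Sum>i\<in>?A. if i = ?i0 then a * ?F ?i0 else 0)"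
    by (intro sum.cong) auto
  also have "\<dots> = a * ?F ?i0"
    using mem by (subst sum.delta) (auto intro: finite_PiE)
  also have "?F ?i0 = (\<Prod>m<p. if m \<in> S then y $ m else 1)"
    by (intro prod.cong) (auto simp: affine_basis_def)
  also have "\<dots> = prod (($) y) S"
    using assms by (intro prod_if_subset) auto
  finally show ?thesis .
qed

lemma functional_tensor_layer_map:
  assumes "p \<ge> 2" "layer_within p l"
  shows "functional_tensor affine_basis p (layer_map p l)"
proof -
  obtain S c c' T e e' where l: "l = ((S, c, c'), (T, e, e'))"
    by (cases l; cases "fst l"; cases "snd l") auto
  have ST: "S \<subseteq> {1..<p}" "T \<subseteq> {1..<p}" using assms(2) by (auto simp: l layer_within_def)
  define ind where "ind = (\<lambda>S. \<lambda>m\<in>{..<p}. of_bool (m \<in> S) :: nat)"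
  \<comment> \<open>Each update consists of two monomials, as its factor \<open>y $ 0\<close>
    enlarges \<open>S\<close> to \<open>insert 0 S\<close>. The four contributions are added because
    their indices may coincide, for example if \<open>S = T\<close>.\<close>
  define C where "C = (\<lambda>j i. (if i = ind S then c j else 0) + (if i = ind (insert 0 S) then c' j else 0) +
    (if i = ind T then e j else 0) + (if i = ind (insert 0 T) then e' j else (0::real)))"
  have "layer_map p l y $ j = (\<Sum>i \<in> {..<p} \<rightarrow>\<^sub>E {..<length affine_basis}. C j i * (\<Prod>m<p. (affine_basis ! i m) (y $ m)))"
    if "j < p" for y j
  proof -
    have mono: "(\<Sum>i \<in> {..<p} \<rightarrow>\<^sub>E {..<2}. (if i = ind S then a else 0) *
      (\<Prod>m<p. (affine_basis ! i m) (y $ m))) = a * prod (($) y) S" if "S \<subseteq> {..<p}" for a S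
      unfolding ind_def by (rule functional_tensor_monomial[OF that])
    have sub: "S \<subseteq> {..<p}" "T \<subseteq> {..<p}" "insert 0 S \<subseteq> {..<p}" "insert 0 T \<subseteq> {..<p}"
      using ST assms(1) by auto
    have fin: "finite S" "finite T" using ST by (auto dest: finite_subset)
    have "0 \<notin> S" "0 \<notin> T" using ST by auto
    then show ?thesis using that fin
      by (simp add: C_def distrib_right sum.distrib mono sub layer_map_def l algebra_simps)
  qed
  then show ?thesis
    unfolding functional_tensor_def by (intro exI[of _ C]) (auto simp: layer_map_def)
qed

lemma tt_represents_layer:
  assumes "p \<ge> 2" "layer_within p l"
  shows "tt_represents affine_basis p (layer_ranks p) (layer_cores p l) (layer_map p l)"
  using assms
  by (auto simp: tt_represents_def functional_tensor_layer_map cores_with_ranks tt_eval_layer_cores)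

text \<open>The cores that \<open>layer_cores\<close> assigns to a zero layer still contain ones.
  All-zero cores of the same shape represent the same map without any non-zero parameter; they serve
  as padding.\<close>

definition zero_cores :: "nat \<Rightarrow> tt_cores" where
  "zero_cores p = map (\<lambda>i. replicate 2 (0\<^sub>m (layer_ranks p i) (layer_ranks p (Suc i)))) [0..<p]"

definition zero_layer :: layer where
  "zero_layer = (({}, (\<lambda>_. 0), (\<lambda>_. 0)), ({}, (\<lambda>_. 0), (\<lambda>_. 0)))"

lemma zero_layer_within [simp]: "layer_within p zero_layer"
  by (simp add: zero_layer_def layer_within_def)

lemma run_zero_layer [simp]: "run_layer zero_layer f = f"
  by (rule ext) (simp add: zero_layer_def run_layer_def)

lemma tt_represents_zero_layer:
  assumes "p \<ge> 2"
  shows "tt_represents affine_basis p (layer_ranks p) (zero_cores p) (layer_map p zero_layer)"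
proof -
  have "tt_eval affine_basis (zero_cores p) y = layer_map p zero_layer y" for y
  proof -
    \<comment> \<open>Core 0 vanishes identically, hence so does the whole product; of the other
      factors only the dimensions matter.\<close>
    have "core_eval affine_basis (replicate 2 (0\<^sub>m p 2)) t = 0\<^sub>m p 2" for t
      by (intro eq_matI) (auto simp: core_eval_def)
    moreover have "dim_row (foldr (*) (map f [1..<p]) (1\<^sub>m 1)) = 2 \<and> dim_col (foldr (*) (map f [1..<p]) (1\<^sub>m 1)) = 1"
      if "\<And>i. 0 < i \<Longrightarrow> i < p \<Longrightarrow> f i \<in> carrier_mat 2 (layer_ranks p (Suc i))" for f :: "nat \<Rightarrow> real mat"
    proof -
      have "foldr (*) (map f [k..<p]) (1\<^sub>m 1) \<in> carrier_mat 2 1" if "0 < k" "k < p" for k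
        using that
      proof (induction "p - Suc k" arbitrary: k)
        case 0
        then have k: "Suc k = p" by simp
        then have "[k..<p] = [k]" by (auto simp flip: k)
        with \<open>\<And>i. 0 < i \<Longrightarrow> i < p \<Longrightarrow> f i \<in> carrier_mat 2 (layer_ranks p (Suc i))\<close>[of k] 0 k
        show ?case by (auto simp: layer_ranks_def)
      next
        case (Suc n)
        then have "Suc k < p" by auto
        then have k: "[k..<p] = k # [Suc k..<p]" by (simp add: upt_conv_Cons)
        have "foldr (*) (map f [Suc k..<p]) (1\<^sub>m 1) \<in> carrier_mat 2 1"
          using Suc by (intro Suc.hyps(1)) auto
        then show ?case
          using that(1) Suc.prems \<open>\<And>i. 0 < i \<Longrightarrow> i < p \<Longrightarrow> f i \<in> carrier_mat 2 (layer_ranks p (Suc i))\<close>[of k] \<open>Suc k < p\<close>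
          by (auto simp: k layer_ranks_def)
      qed
      from this[of 1] show ?thesis using assms by auto
    qed
    note dims = this[of "\<lambda>i. core_eval affine_basis (zero_cores p ! i) (y $ i)"]
    have "dim_row (foldr (*) (map (\<lambda>i. core_eval affine_basis (zero_cores p ! i) (y $ i)) [1..<p]) (1\<^sub>m 1)) = 2 \<and>
      dim_col (foldr (*) (map (\<lambda>i. core_eval affine_basis (zero_cores p ! i) (y $ i)) [1..<p]) (1\<^sub>m 1)) = 1"
      by (rule dims) (auto simp: core_eval_def zero_cores_def layer_ranks_def)
    moreover have "[0..<p] = 0 # [1..<p]" using assms by (simp add: upt_conv_Cons)
    ultimately show ?thesis
      using assms
      by (intro eq_vecI)
        (auto simp: tt_eval_def zero_cores_def layer_map_def zero_layer_def layer_ranks_def scalar_prod_def)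
  qed
  moreover have "tt_cores_with_ranks affine_basis p (layer_ranks p) (zero_cores p)"
    using assms by (auto simp: tt_cores_with_ranks_def zero_cores_def layer_ranks_def all_less_2)
  ultimately show ?thesis
    using functional_tensor_layer_map[OF assms, of zero_layer] by (simp add: tt_represents_def)
qed

section \<open>Bounds on ranks and numbers of parameters\<close>

lemma tt_rank_le:
  assumes "tt_represents \<Phi> p r U f"
  shows "tt_rank \<Phi> p f k \<le> r k"
  unfolding tt_rank_def by (rule Least_le) (use assms in blast)

lemma num_nonzero_params_le: "num_nonzero_params U \<le> num_params U"
proof -
  have "card {(a, b). a < dim_row A \<and> b < dim_col A \<and> A $$ (a, b) \<noteq> 0} \<le> dim_row A * dim_col A" for A :: "real mat"
  proof -
    have "{(a, b). a < dim_row A \<and> b < dim_col A \<and> A $$ (a, b) \<noteq> 0} \<subseteq> {..<dim_row A} \<times> {..<dim_col A}"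
      by auto
    from card_mono[OF _ this] show ?thesis by simp
  qed
  then show ?thesis
    unfolding num_nonzero_params_def num_params_def by (intro sum_list_mono)
qed

text \<open>Core 0 has two \<open>p\<close> by 2 matrices, that is, \<open>4 * p\<close> entries;
  each other core has two matrices with at most 4 entries each.\<close>

lemma num_params_le:
  assumes "tt_cores_with_ranks affine_basis p (layer_ranks p) U" "p \<ge> 2"
  shows "num_params U \<le> 12 * p"
proof -
  have U: "length U = p" "\<And>i. i < p \<Longrightarrow> length (U ! i) = 2"
    "\<And>i k. i < p \<Longrightarrow> k \<in> {..<2} \<Longrightarrow> U ! i ! k \<in> carrier_mat (layer_ranks p i) (layer_ranks p (Suc i))"
    using assms(1) by (auto simp: tt_cores_with_ranks_def)
  have core: "(\<Sum>A\<leftarrow>U ! i. dim_row A * dim_col A) = 2 * (layer_ranks p i * layer_ranks p (Suc i))"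
    if "i < p" for i
  proof -
    have "(\<Sum>A\<leftarrow>U ! i. dim_row A * dim_col A) = (\<Sum>k<2. dim_row (U ! i ! k) * dim_col (U ! i ! k))"
      using U(2)[OF that] by (simp add: sum_list_sum_nth atLeast0LessThan)
    also have "\<dots> = (\<Sum>k<2::nat. layer_ranks p i * layer_ranks p (Suc i))"
    proof (intro sum.cong refl)
      fix k :: nat
      assume "k \<in> {..<2}"
      then have "U ! i ! k \<in> carrier_mat (layer_ranks p i) (layer_ranks p (Suc i))"
        using U(3)[OF that] by blast
      from carrier_matD[OF this] show "dim_row (U ! i ! k) * dim_col (U ! i ! k) = layer_ranks p i * layer_ranks p (Suc i)"
        by simp
    qed
    finally show ?thesis by simp
  qed
  have "num_params U = (\<Sum>i<p. 2 * (layer_ranks p i * layer_ranks p (Suc i)))"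
    using U(1) core by (simp add: num_params_def sum_list_sum_nth atLeast0LessThan)
  also have "\<dots> \<le> (\<Sum>i<p. (if i = 0 then 4 * p else 0) + 8)"
    using assms(2) by (intro sum_mono) (auto simp: layer_ranks_def)
  also have "\<dots> = 12 * p"
    using assms(2) by (simp add: sum.distrib)
  finally show ?thesis .
qed

lemma num_nonzero_params_zero_cores: "num_nonzero_params (zero_cores p) = 0"
proof -
  have "card {(a, b). a < m \<and> b < n \<and> (0\<^sub>m m n :: real mat) $$ (a, b) \<noteq> 0} = 0" for m n
    by (auto intro!: card_eq_0_iff[THEN iffD2])
  then show ?thesis
    by (auto simp: num_nonzero_params_def zero_cores_def numeral_2_eq_2 sum_list_0 comp_def)
qed

fun keeps :: "upd \<Rightarrow> nat \<Rightarrow> bool" where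
  "keeps (S, c, c') i \<longleftrightarrow> c i = 0 \<and> c' i = 0"

section \<open>Sequences of updates\<close>

lemma upd_val_pair [simp]: "upd_val (S, C) f j = (fst C j + snd C j * f 0) * prod f S"
  and upd_within_pair [simp]: "upd_within p (S, C) \<longleftrightarrow> S \<subseteq> {1..<p}"
  and keeps_pair [simp]: "keeps (S, C) i \<longleftrightarrow> fst C i = 0 \<and> snd C i = 0"
  by (cases C; simp)+

text \<open>
  No update changes what a later one reads, so packing two updates into each layer has the same
  effect as applying all of them at once.
\<close>

definition separated :: "upd list \<Rightarrow> bool" where
  "separated us \<longleftrightarrow> sorted_wrt (\<lambda>u w. \<forall>i\<in>insert 0 (fst w). keeps u i) us"

fun pairs :: "upd list \<Rightarrow> layer list" where
  "pairs [] = []"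
| "pairs [u] = [(u, ({}, (\<lambda>_. 0), (\<lambda>_. 0)))]"
| "pairs (u # v # us) = (u, v) # pairs us"

lemma length_pairs: "length (pairs us) = Suc (length us) div 2"
  by (induction us rule: pairs.induct) auto

lemma pairs_within:
  "(\<forall>u\<in>set us. upd_within p u) \<Longrightarrow> \<forall>l\<in>set (pairs us). layer_within p l"
  by (induction us rule: pairs.induct) (auto simp: layer_within_def)

lemma upd_val_keeps: "keeps u i \<Longrightarrow> upd_val u f i = 0"
  by (cases u) auto

lemma upd_val_cong:
  assumes "\<And>i. i \<in> insert 0 (fst u) \<Longrightarrow> f i = g i"
  shows "upd_val u f j = upd_val u g j"
proof -
  obtain S c c' where u: "u = (S, c, c')" by (cases u) auto
  have "prod f S = prod g S" using assms u by (intro prod.cong) auto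
  then show ?thesis using assms u by simp
qed

lemma run_pairs:
  "separated us \<Longrightarrow> run (pairs us) f j = f j + (\<Sum>u\<leftarrow>us. upd_val u f j)"
proof (induction us arbitrary: f rule: pairs.induct)
  case (3 u v us)
  have sep: "separated us" and kp: "\<And>w i. w \<in> set us \<Longrightarrow> i \<in> insert 0 (fst w) \<Longrightarrow> keeps u i \<and> keeps v i"
    using "3.prems" by (auto simp: separated_def)
  have "upd_val w (run_layer (u, v) f) j = upd_val w f j" if "w \<in> set us" for w
    by (rule upd_val_cong) (use kp[OF that] in \<open>auto simp: run_layer_def upd_val_keeps\<close>)
  then have "(\<Sum>w\<leftarrow>us. upd_val w (run_layer (u, v) f) j) = (\<Sum>w\<leftarrow>us. upd_val w f j)"
    by (metis (no_types, lifting) map_eq_conv)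
  moreover have "run_layer (u, v) f j = f j + upd_val u f j + upd_val v f j"
    by (simp add: run_layer_def)
  ultimately show ?case using "3.IH"[OF sep] by simp
qed (auto simp: run_layer_def)

type_synonym pattern = "(nat \<Rightarrow> real) \<times> (nat \<Rightarrow> real)"

definition put :: "(nat \<Rightarrow> real) \<Rightarrow> pattern \<Rightarrow> real \<Rightarrow> nat \<Rightarrow> real" where
  "put e C A j = e j + (fst C j + snd C j * e 0) * A"

text \<open>
  The state of a computation has the form \<open>put e C A\<close>: a background \<open>e\<close> plus copies of \<open>A\<close> and
  \<open>A * e 0\<close>. A power layer erases these copies by means of a pure copy of \<open>A\<close> at \<open>\<rho>\<close> and writes
  the monomial given by \<open>S\<close> according to the next pattern.
\<close>

definition power_layer :: "nat set \<Rightarrow> nat \<Rightarrow> pattern \<Rightarrow> pattern \<Rightarrow> layer" where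
  "power_layer S \<rho> C D = ((S, fst D, snd D), ({\<rho>}, (\<lambda>j. - fst C j), (\<lambda>j. - snd C j)))"

lemma run_power_layer:
  assumes "fst C 0 = 0" "snd C 0 = 0" "e \<rho> = 0" "fst C \<rho> = 1" "snd C \<rho> = 0"
  shows "run_layer (power_layer S \<rho> C D) (put e C A) = put e D (prod (put e C A) S)"
  by (rule ext) (use assms in \<open>simp add: run_layer_def power_layer_def put_def algebra_simps\<close>)

definition init_layer :: "nat \<Rightarrow> pattern \<Rightarrow> layer" where
  "init_layer j C = (({}, fst C, (\<lambda>k. if k = 0 then -1 else 0)), ({Suc j}, (snd C)(0 := 1), (\<lambda>_. 0)))"

lemma run_init_layer:
  assumes "fst C 0 = 0" "snd C 0 = 0"
  shows "run_layer (init_layer j C) f = put (f(0 := f (Suc j))) C 1"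
  by (rule ext) (use assms in \<open>auto simp: run_layer_def init_layer_def put_def algebra_simps\<close>)

section \<open>Horner's rule in a mixed radix\<close>

text \<open>For radix lists built from constant blocks, this identifies the radix of a Horner step
  and the radices that make up its place value.\<close>

lemma replicate_append_eq:
  assumes "replicate n r0 @ ys = us @ r # vs"
  shows "(r = r0 \<and> (\<exists>t<n. vs = replicate t r0 @ ys)) \<or> (\<exists>us'. ys = us' @ r # vs)"
  using assms
proof (induction n arbitrary: us)
  case (Suc n)
  then show ?case by (cases us) (auto simp: less_Suc_eq)
qed auto

text \<open>
  The exponents of one monomial and its variable with the most digits. Entry 0 holds \<open>x\<^sub>j\<^sub>1\<close>, entry
  \<open>Suc j\<close> holds \<open>x\<^sub>j\<close>, entry \<open>Suc d\<close> accumulates the polynomial, and the \<open>q\<close> remaining entries are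
  the slots.
\<close>

locale workspace =
  fixes d q j1 :: nat and \<alpha> :: "nat \<Rightarrow> nat"
  assumes j1: "j1 < d" and q: "q \<ge> 2"
begin

definition slot :: "nat \<Rightarrow> nat" where
  "slot i = d + 2 + i"

definition on_slots :: "(nat \<Rightarrow> real) \<Rightarrow> nat \<Rightarrow> real" where
  "on_slots g j = (if d + 2 \<le> j then g (j - (d + 2)) else 0)"

lemma on_slots_simps [simp]:
  "on_slots g (slot i) = g i" "on_slots g 0 = 0" "j < d \<Longrightarrow> on_slots g (Suc j) = 0" "on_slots g (Suc d) = 0"
  by (auto simp: on_slots_def slot_def)

lemma on_slots_outside:
  assumes "k \<notin> slot ` I" "\<And>i. i \<notin> I \<Longrightarrow> g i = 0"
  shows "on_slots g k = 0"
proof (cases "d + 2 \<le> k")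
  case True
  then have "k = slot (k - (d + 2))" by (simp add: slot_def)
  with assms(1) have "k - (d + 2) \<notin> I" by blast
  with assms(2) True show ?thesis by (simp add: on_slots_def)
qed (simp add: on_slots_def)

lemma slot_neq [simp]: "slot i \<noteq> 0" "0 \<noteq> slot i" "j < d \<Longrightarrow> slot i \<noteq> Suc j" "j < d \<Longrightarrow> Suc j \<noteq> slot i"
  "slot i = slot k \<longleftrightarrow> i = k"
  by (auto simp: slot_def)

lemma inj_slot: "inj_on slot I"
  by (auto simp: inj_on_def)

definition holds :: "(nat \<Rightarrow> real) \<Rightarrow> (nat \<Rightarrow> real) \<Rightarrow> bool" where
  "holds x e \<longleftrightarrow> e 0 = x j1 \<and> (\<forall>j<d. e (Suc j) = x j)"

definition digit :: "nat \<Rightarrow> nat \<Rightarrow> nat \<Rightarrow> nat" where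
  "digit R r j = \<alpha> j div R mod r"

text \<open>The part of the monomial that belongs to the digits from place value \<open>R\<close>
  on; \<open>R = 1\<close> gives the full monomial.\<close>

definition monomial :: "(nat \<Rightarrow> real) \<Rightarrow> nat \<Rightarrow> real" where
  "monomial x R = (\<Prod>j<d. x j ^ (\<alpha> j div R))"

text \<open>Horner's identity: the exponent \<open>\<alpha> j div R\<close> is \<open>r\<close>
  times \<open>\<alpha> j div (r * R)\<close> plus a digit.\<close>

lemma monomial_step:
  "monomial x (r * R) ^ r * (\<Prod>j<d. x j ^ digit R r j) = monomial x R"
proof -
  have "x j ^ (\<alpha> j div (r * R) * r) * x j ^ digit R r j = x j ^ (\<alpha> j div R)" for j
    by (simp add: digit_def mult.commute[of r R] div_mult2_eq flip: power_add)
  then show ?thesis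
    by (simp add: monomial_def prod_power_distrib flip: prod.distrib power_mult)
qed

text \<open>Copies of \<open>A\<close> in \<open>r\<close> slots; those in slots \<open>1, \<dots>, b\<close> carry a factor \<open>x\<^sub>j\<^sub>1\<close>. Slot 0 is pure.\<close>

definition pat :: "nat \<Rightarrow> nat \<Rightarrow> pattern" where
  "pat r b = (on_slots (\<lambda>i. of_bool (i < r \<and> \<not> (1 \<le> i \<and> i \<le> b))), on_slots (\<lambda>i. of_bool (i < r \<and> 1 \<le> i \<and> i \<le> b)))"

text \<open>\<open>cp j s\<close> is the entry with the \<open>s\<close>-th copy of \<open>x\<^sub>j\<close>, so that a digit \<open>a j\<close> needs that many copies.\<close>

definition factors :: "(nat \<Rightarrow> nat \<Rightarrow> nat) \<Rightarrow> nat \<Rightarrow> (nat \<Rightarrow> nat) \<Rightarrow> nat set" where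
  "factors cp r a = slot ` {..<r} \<union> (\<Union>j\<in>{..<d} - {j1}. cp j ` {..<a j})"

text \<open>An update multiplies entries over a set, so no entry counts twice; a power of a variable
  requires distinct entries with equal contents.\<close>

definition supplies :: "(nat \<Rightarrow> nat \<Rightarrow> nat) \<Rightarrow> (nat \<Rightarrow> real) \<Rightarrow> (nat \<Rightarrow> real) \<Rightarrow> nat \<Rightarrow> (nat \<Rightarrow> nat) \<Rightarrow> bool" where
  "supplies cp e x r a \<longleftrightarrow>
     (\<forall>j\<in>{..<d} - {j1}. \<forall>s<a j. cp j s \<notin> slot ` {..<r} \<and> e (cp j s) = x j) \<and>
     inj_on (\<lambda>(j, s). cp j s) (SIGMA j:{..<d} - {j1}. {..<a j})"

lemma prod_pattern_slots:
  assumes "b < r"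
  shows "(\<Prod>i<r. A * (if 1 \<le> i \<and> i \<le> b then B else 1)) = A ^ r * (B :: real) ^ b"
proof -
  have "(\<Prod>i<r. if 1 \<le> i \<and> i \<le> b then B else 1) = (\<Prod>i\<in>{1..b}. B)"
    by (intro prod.mono_neutral_cong_right) (use assms in auto)
  then show ?thesis by (simp add: prod.distrib)
qed

text \<open>The slots supply \<open>A ^ r\<close> and, through their marked copies, the power of
  \<open>x j1\<close>; the copies supply all other powers. Disjointness and injectivity from
  \<open>supplies\<close> keep factors from being merged.\<close>

lemma prod_factors:
  assumes "holds x e" "supplies cp e x r a" "a j1 < r" "\<And>i. i < r \<Longrightarrow> e (slot i) = 0"
  shows "prod (put e (pat r (a j1)) A) (factors cp r a) = A ^ r * (\<Prod>j<d. x j ^ a j)"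
proof -
  let ?f = "put e (pat r (a j1)) A"
  let ?J = "{..<d} - {j1}"
  have cp: "cp j s \<notin> slot ` {..<r}" "e (cp j s) = x j" if "j \<in> ?J" "s < a j" for j s
    using assms(2) that by (auto simp: supplies_def)
  have dj: "slot ` {..<r} \<inter> (\<Union>j\<in>?J. cp j ` {..<a j}) = {}"
  proof (intro equals0I)
    fix y assume y: "y \<in> slot ` {..<r} \<inter> (\<Union>j\<in>?J. cp j ` {..<a j})"
    then obtain j s where "j \<in> ?J" "s < a j" "y = cp j s" by auto
    with cp(1)[of j s] y show False by simp
  qed
  have f_cp: "?f (cp j s) = x j" if "j \<in> ?J" "s < a j" for j s
  proof -
    have "fst (pat r (a j1)) (cp j s) = 0 \<and> snd (pat r (a j1)) (cp j s) = 0"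
      using cp(1)[OF that] by (auto simp: pat_def intro!: on_slots_outside[where I = "{..<r}"])
    with cp(2)[OF that] show ?thesis by (simp add: put_def)
  qed
  have "prod ?f (factors cp r a) = prod ?f (slot ` {..<r}) * prod ?f (\<Union>j\<in>?J. cp j ` {..<a j})"
    unfolding factors_def by (rule prod.union_disjoint) (use dj in auto)
  also have "prod ?f (slot ` {..<r}) = (\<Prod>i<r. A * (if 1 \<le> i \<and> i \<le> a j1 then x j1 else 1))"
    by (subst prod.reindex[OF inj_slot], intro prod.cong refl)
      (use assms in \<open>auto simp: put_def pat_def holds_def algebra_simps\<close>)
  also have "\<dots> = A ^ r * x j1 ^ a j1"
    using assms(3) by (rule prod_pattern_slots)
  also have "(\<Union>j\<in>?J. cp j ` {..<a j}) = (\<lambda>(j, s). cp j s) ` (SIGMA j:?J. {..<a j})"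
    by auto
  also have "prod ?f \<dots> = (\<Prod>(j, s)\<in>(SIGMA j:?J. {..<a j}). x j)"
    using assms(2) f_cp by (subst prod.reindex) (auto simp: supplies_def intro!: prod.cong)
  also have "\<dots> = (\<Prod>j\<in>?J. x j ^ a j)"
    by (subst prod.Sigma[symmetric]) auto
  also have "A ^ r * x j1 ^ a j1 * (\<Prod>j\<in>?J. x j ^ a j) = A ^ r * (\<Prod>j<d. x j ^ a j)"
    using j1 by (subst (2) prod.remove[of _ j1]) auto
  finally show ?thesis .
qed

text \<open>A power layer already writes the pattern of its successor: the slots that carry the
  factor \<open>x j1\<close> are determined by the digit consumed next.\<close>

fun first_pat :: "nat list \<Rightarrow> nat \<Rightarrow> pattern \<Rightarrow> pattern" where
  "first_pat [] R D = D"
| "first_pat (r # rs) R D = pat r (digit (prod_list rs * R) r j1)"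

fun horner :: "(nat \<Rightarrow> nat \<Rightarrow> nat) \<Rightarrow> nat list \<Rightarrow> nat \<Rightarrow> pattern \<Rightarrow> layer list" where
  "horner cp [] R D = []"
| "horner cp (r # rs) R D =
     power_layer (factors cp r (digit (prod_list rs * R) r)) (slot 0) (first_pat (r # rs) R D) (first_pat rs R D) #
     horner cp rs R D"

lemma length_horner [simp]: "length (horner cp rs R D) = length rs"
  by (induction rs) auto

text \<open>The most significant radix comes first, and the place value below a radix
  \<open>r\<close> is \<open>prod_list vs * R\<close>; this is why the conditions range over all
  splittings of the list.\<close>

lemma run_horner:
  assumes "holds x e"
    and "\<And>us r vs. rs = us @ r # vs \<Longrightarrow> r > 0 \<and> supplies cp e x r (digit (prod_list vs * R) r) \<and> (\<forall>i<r. e (slot i) = 0)"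
  shows "run (horner cp rs R D) (put e (first_pat rs R D) (monomial x (prod_list rs * R))) = put e D (monomial x R)"
  using assms(2)
proof (induction rs)
  case (Cons r rs)
  let ?a = "digit (prod_list rs * R) r"
  have r: "r > 0" "supplies cp e x r ?a" "\<And>i. i < r \<Longrightarrow> e (slot i) = 0"
    using Cons.prems[of "[]" r rs] by auto
  have "?a j1 < r" using r by (simp add: digit_def)
  have "run_layer (hd (horner cp (r # rs) R D)) (put e (first_pat (r # rs) R D) (monomial x (prod_list (r # rs) * R)))
     = put e (first_pat rs R D) (prod (put e (pat r (?a j1)) (monomial x (prod_list (r # rs) * R))) (factors cp r ?a))"
    unfolding horner.simps list.sel first_pat.simps
    by (rule run_power_layer) (use r in \<open>auto simp: pat_def\<close>)
  also have "\<dots> = put e (first_pat rs R D) (monomial x (prod_list rs * R))"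
    using prod_factors[OF assms(1) r(2) \<open>?a j1 < r\<close> r(3)] monomial_step[of x r "prod_list rs * R"]
    by (simp add: mult.assoc)
  moreover have "run (horner cp rs R D) (put e (first_pat rs R D) (monomial x (prod_list rs * R))) = put e D (monomial x R)"
    by (rule Cons.IH) (use Cons.prems[of "r # _"] in auto)
  ultimately show ?case by simp
qed auto

lemma horner_within:
  assumes "p = d + 2 + q" "\<And>r. r \<in> set rs \<Longrightarrow> r \<le> q"
    and "\<And>us r vs j s. rs = us @ r # vs \<Longrightarrow> j < d \<Longrightarrow> j \<noteq> j1 \<Longrightarrow> s < digit (prod_list vs * R) r j \<Longrightarrow> cp j s \<in> {1..<p}"
  shows "\<forall>l\<in>set (horner cp rs R D). layer_within p l"
  using assms(2,3)
proof (induction rs)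
  case (Cons r rs)
  have "factors cp r (digit (prod_list rs * R) r) \<subseteq> {1..<p}"
    using Cons.prems(1)[of r] Cons.prems(2)[of "[]" r rs] by (fastforce simp: factors_def slot_def assms(1))
  then have "layer_within p (hd (horner cp (r # rs) R D))"
    using q by (simp add: layer_within_def power_layer_def slot_def assms(1))
  moreover have "\<forall>l\<in>set (horner cp rs R D). layer_within p l"
    by (rule Cons.IH) (use Cons.prems(1) Cons.prems(2)[of "r # _"] in auto)
  ultimately show ?case by simp
qed auto

section \<open>Levels with nested products of variables\<close>

text \<open>
  In base \<open>q\<close>, slot \<open>i\<close> receives the factor \<open>x\<^sub>j\<close> for \<open>i \<ge> q - a\<^sub>j\<close> (and \<open>x\<^sub>j\<^sub>1\<close> for \<open>1 \<le> i \<le> a\<^sub>j\<^sub>1\<close>). Capping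
  the digits at \<open>q - 2\<close> keeps slots 0 and 1 free of nested products; a digit \<open>q - 1\<close> takes its last
  factor from the entry of the variable itself. The products that occur are nested, so there are no more
  of them than variables. The slots with a product are not overwritten by the power layer; they become
  stale and are erased by reading one slot for each product.
\<close>

definition cap :: "(nat \<Rightarrow> nat) \<Rightarrow> nat \<Rightarrow> nat" where
  "cap a j = min (a j) (q - 2)"

definition vars_at :: "(nat \<Rightarrow> nat) \<Rightarrow> nat \<Rightarrow> nat set" where
  "vars_at a i = {j. j < d \<and> j \<noteq> j1 \<and> q - cap a j \<le> i}"

text \<open>The last slot always belongs to this set. Hence no \<open>plain\<close> pattern writes
  it, and the remains of a level with a single block can be erased from there while the next level
  is prepared.\<close>

definition special :: "(nat \<Rightarrow> nat) \<Rightarrow> nat set" where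
  "special a = {i. i < q \<and> (i = q - 1 \<or> vars_at a i \<noteq> {})}"

definition marked :: "(nat \<Rightarrow> nat) \<Rightarrow> nat \<Rightarrow> bool" where
  "marked a i \<longleftrightarrow> 1 \<le> i \<and> i \<le> cap a j1"

definition plain :: "(nat \<Rightarrow> nat) \<Rightarrow> pattern" where
  "plain a = (on_slots (\<lambda>i. of_bool (i < q \<and> i \<notin> special a \<and> \<not> marked a i)),
              on_slots (\<lambda>i. of_bool (i < q \<and> i \<notin> special a \<and> marked a i)))"

definition kind :: "(nat \<Rightarrow> real) \<Rightarrow> (nat \<Rightarrow> nat) \<Rightarrow> nat \<Rightarrow> real" where
  "kind x a i = (\<Prod>j\<in>vars_at a i. x j) * (if marked a i then x j1 else 1)"

definition stale :: "(nat \<Rightarrow> real) \<Rightarrow> (nat \<Rightarrow> nat) \<Rightarrow> real \<Rightarrow> nat \<Rightarrow> real" where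
  "stale x a A = on_slots (\<lambda>i. if i \<in> special a then A * kind x a i else 0)"

definition block :: "(nat \<Rightarrow> nat) \<Rightarrow> nat \<Rightarrow> nat set" where
  "block a \<rho> = {i \<in> special a. vars_at a i = vars_at a \<rho>}"

text \<open>
  The last slot of a block is unmarked unless the whole block is marked, hence the block can be erased
  with coefficients that are affine in entry 0.
\<close>

definition reps :: "(nat \<Rightarrow> nat) \<Rightarrow> nat list" where
  "reps a = filter (\<lambda>i. i \<in> special a \<and> (\<forall>k\<in>block a i. k \<le> i)) [0..<q]"

definition fill_upd :: "(nat \<Rightarrow> nat) \<Rightarrow> nat \<Rightarrow> upd" where
  "fill_upd a \<rho> = (insert (slot 0) (Suc ` vars_at a \<rho>),
     on_slots (\<lambda>i. of_bool (i \<in> block a \<rho> \<and> \<not> marked a i)), on_slots (\<lambda>i. of_bool (i \<in> block a \<rho> \<and> marked a i)))"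

definition wipe_upd :: "(nat \<Rightarrow> nat) \<Rightarrow> nat \<Rightarrow> upd" where
  "wipe_upd a \<rho> = ({slot \<rho>},
     on_slots (\<lambda>i. - of_bool (i \<in> block a \<rho> \<and> marked a i = marked a \<rho>)),
     on_slots (\<lambda>i. - of_bool (i \<in> block a \<rho> \<and> marked a i \<noteq> marked a \<rho>)))"

definition even_factors :: "(nat \<Rightarrow> nat) \<Rightarrow> nat set" where
  "even_factors a = slot ` {..<q} \<union> Suc ` {j. j < d \<and> a j = q - 1}"

lemma special_ge: "i \<in> special a \<Longrightarrow> i \<noteq> 0"
  using q by (auto simp: special_def vars_at_def cap_def)

lemma vars_at_finite [simp]: "finite (vars_at a i)"
  by (simp add: vars_at_def)

lemma rep_props:
  assumes "\<rho> \<in> set (reps a)"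
  shows "\<rho> \<in> special a" "\<rho> < q" "\<rho> \<in> block a \<rho>" "\<And>i. i \<in> block a \<rho> \<Longrightarrow> i \<le> \<rho>"
  using assms by (auto simp: reps_def block_def special_def)

lemma rep_exists:
  assumes "i \<in> special a"
  obtains \<rho> where "\<rho> \<in> set (reps a)" "i \<in> block a \<rho>"
proof -
  let ?\<rho> = "Max (block a i)"
  have fin: "finite (block a i)" "i \<in> block a i"
    using assms by (auto simp: block_def special_def)
  then have m: "?\<rho> \<in> block a i" by (intro Max_in) auto
  then have g: "block a ?\<rho> = block a i" by (auto simp: block_def)
  have "?\<rho> \<in> set (reps a)"
    using m fin(1) g by (auto simp: reps_def) (auto simp: block_def special_def)
  with g fin(2) that show ?thesis by blast
qed

lemma rep_unique:
  assumes "\<rho> \<in> set (reps a)" "\<rho>' \<in> set (reps a)" "i \<in> block a \<rho>" "i \<in> block a \<rho>'"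
  shows "\<rho> = \<rho>'"
proof -
  have "\<rho> \<in> block a \<rho>'" "\<rho>' \<in> block a \<rho>"
    using assms rep_props[of \<rho> a] rep_props[of \<rho>' a] by (auto simp: block_def)
  then show ?thesis using rep_props(4)[OF assms(1)] rep_props(4)[OF assms(2)] by (meson le_antisym)
qed

lemma distinct_reps: "distinct (reps a)"
  by (simp add: reps_def)

text \<open>Each special slot lies in the block of exactly one representative, so at most one
  summand contributes.\<close>

lemma sum_reps:
  fixes g :: "nat \<Rightarrow> real"
  assumes "\<And>\<rho>. \<rho> \<in> set (reps a) \<Longrightarrow> i \<notin> block a \<rho> \<Longrightarrow> g \<rho> = 0"
    and "\<And>\<rho>. \<rho> \<in> set (reps a) \<Longrightarrow> i \<in> block a \<rho> \<Longrightarrow> g \<rho> = v"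
  shows "(\<Sum>\<rho>\<leftarrow>reps a. g \<rho>) = (if i \<in> special a then v else 0)"
proof -
  have eq: "(\<Sum>\<rho>\<leftarrow>reps a. g \<rho>) = (\<Sum>\<rho>\<in>set (reps a). g \<rho>)"
    by (rule sum_list_distinct_conv_sum_set[OF distinct_reps])
  show ?thesis
  proof (cases "i \<in> special a")
    case True
    then obtain \<rho> where \<rho>: "\<rho> \<in> set (reps a)" "i \<in> block a \<rho>" by (rule rep_exists)
    have z: "g \<rho>' = 0" if "\<rho>' \<in> set (reps a)" "\<rho>' \<noteq> \<rho>" for \<rho>'
      by (rule assms(1)[OF that(1)]) (use rep_unique[OF that(1) \<rho>(1) _ \<rho>(2)] that(2) in blast)
    have "(\<Sum>\<rho>'\<in>set (reps a). g \<rho>') = (\<Sum>\<rho>'\<in>{\<rho>}. g \<rho>')"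
      by (intro sum.mono_neutral_right) (use \<rho>(1) z in auto)
    with True \<rho> assms(2) eq show ?thesis by simp
  next
    case False
    then have "\<And>\<rho>. i \<notin> block a \<rho>" by (simp add: block_def)
    with False assms(1) eq show ?thesis by simp
  qed
qed

lemma sum_fill:
  assumes "holds x f" "f (slot 0) = A"
  shows "(\<Sum>u\<leftarrow>map (fill_upd a) (reps a). upd_val u f k) = stale x a A k"
proof -
  have pr: "prod f (insert (slot 0) (Suc ` vars_at a \<rho>)) = A * (\<Prod>j\<in>vars_at a \<rho>. x j)" for \<rho>
  proof -
    have "slot 0 \<notin> Suc ` vars_at a \<rho>" by (auto simp: vars_at_def)
    then have "prod f (insert (slot 0) (Suc ` vars_at a \<rho>)) = A * prod f (Suc ` vars_at a \<rho>)"
      using assms(2) by simp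
    also have "prod f (Suc ` vars_at a \<rho>) = (\<Prod>j\<in>vars_at a \<rho>. x j)"
      using assms(1) by (subst prod.reindex) (auto simp: vars_at_def holds_def intro!: prod.cong)
    finally show ?thesis .
  qed
  show ?thesis
  proof (cases "d + 2 \<le> k")
    case True
    define i where "i = k - (d + 2)"
    have k: "k = slot i" using True by (simp add: i_def slot_def)
    have "(\<Sum>\<rho>\<leftarrow>reps a. upd_val (fill_upd a \<rho>) f (slot i)) = (if i \<in> special a then A * kind x a i else 0)"
      by (rule sum_reps) (use assms(1) in \<open>auto simp: fill_upd_def pr kind_def block_def holds_def\<close>)
    then show ?thesis by (simp add: k stale_def comp_def)
  next
    case False
    then have "on_slots g k = 0" for g by (simp add: on_slots_def)
    then show ?thesis by (simp add: fill_upd_def stale_def comp_def)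
  qed
qed

lemma marked_mono: "marked a i \<Longrightarrow> k \<le> i \<Longrightarrow> k \<noteq> 0 \<Longrightarrow> marked a k"
  by (auto simp: marked_def)

text \<open>Apart from entry 0, only representatives are read, so the other slots may already hold
  copies for the next level.\<close>

lemma sum_wipe:
  assumes "f 0 = x j1" "\<And>\<rho>. \<rho> \<in> set (reps a) \<Longrightarrow> f (slot \<rho>) = A * kind x a \<rho>"
  shows "(\<Sum>u\<leftarrow>map (wipe_upd a) (reps a). upd_val u f k) = - stale x a A k"
proof (cases "d + 2 \<le> k")
  case True
  define i where "i = k - (d + 2)"
  have k: "k = slot i" using True by (simp add: i_def slot_def)
  have "upd_val (wipe_upd a \<rho>) f (slot i) = - (A * kind x a i)" if "\<rho> \<in> set (reps a)" "i \<in> block a \<rho>" for \<rho>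
  proof -
    have "i \<le> \<rho>" "i \<noteq> 0" "vars_at a i = vars_at a \<rho>"
      using rep_props(4)[OF that] that(2) special_ge[of i a] by (auto simp: block_def)
    then show ?thesis
      using that assms(1) assms(2)[OF that(1)] marked_mono[of a \<rho> i] by (auto simp: wipe_upd_def kind_def)
  qed
  then have "(\<Sum>\<rho>\<leftarrow>reps a. upd_val (wipe_upd a \<rho>) f (slot i)) = (if i \<in> special a then - (A * kind x a i) else 0)"
    by (intro sum_reps) (auto simp: wipe_upd_def)
  then show ?thesis by (simp add: k stale_def comp_def)
next
  case False
  then have "on_slots g k = 0" for g by (simp add: on_slots_def)
  then show ?thesis by (simp add: wipe_upd_def stale_def comp_def)
qed

lemma fill_keeps: "k \<le> d + 2 \<Longrightarrow> keeps (fill_upd a \<rho>) k"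
  using special_ge[of 0 a] by (auto simp: fill_upd_def on_slots_def block_def)

lemma wipe_keeps: "k \<le> d + 2 \<Longrightarrow> keeps (wipe_upd a \<rho>) k"
  using special_ge[of 0 a] by (auto simp: wipe_upd_def on_slots_def block_def)

lemma fill_reads: "k \<in> insert 0 (fst (fill_upd a \<rho>)) \<Longrightarrow> k \<le> d + 2"
  by (auto simp: fill_upd_def slot_def vars_at_def)

text \<open>Fills read only entries up to slot 0, which is entry \<open>d + 2\<close>, and neither
  they nor the updates in \<open>cl\<close> write there. Thus erasures due from the previous level
  and new fills can share layers.\<close>

lemma separated_fill:
  assumes "separated cl" "\<And>u k. u \<in> set cl \<Longrightarrow> k \<le> d + 2 \<Longrightarrow> keeps u k"
  shows "separated (cl @ map (fill_upd a) (reps a))"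
proof -
  have "sorted_wrt (\<lambda>u w. \<forall>i\<in>insert 0 (fst w). keeps u i) (map (fill_upd a) \<rho>s)" for \<rho>s
    by (induction \<rho>s) (use fill_keeps fill_reads in \<open>fastforce+\<close>)
  moreover have "\<forall>u\<in>set cl. \<forall>w\<in>set (map (fill_upd a) (reps a)). \<forall>i\<in>insert 0 (fst w). keeps u i"
  proof (intro ballI)
    fix u w i assume u: "u \<in> set cl" and w: "w \<in> set (map (fill_upd a) (reps a))" and i: "i \<in> insert 0 (fst w)"
    from w obtain \<rho> where "w = fill_upd a \<rho>" by auto
    with i fill_reads have "i \<le> d + 2" by blast
    with u assms(2) show "keeps u i" by blast
  qed
  ultimately show ?thesis
    using assms(1) unfolding separated_def sorted_wrt_append by blast
qed

text \<open>Besides entry 0, a wipe reads only its own representative, and blocks of distinct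
  representatives are disjoint.\<close>

lemma separated_wipe: "separated (map (wipe_upd a) (reps a))"
proof -
  have *: "keeps (wipe_upd a \<rho>) k" if "\<rho> \<in> set (reps a)" "\<rho>' \<in> set (reps a)" "\<rho> \<noteq> \<rho>'" "k \<in> insert 0 (fst (wipe_upd a \<rho>'))" for \<rho> \<rho>' k
  proof -
    have "\<rho>' \<notin> block a \<rho>" using rep_unique[OF that(1,2)] rep_props(3)[OF that(2)] that(3) by blast
    with that(4) show ?thesis by (auto simp: wipe_upd_def)
  qed
  have "sorted_wrt (\<lambda>u w. \<forall>i\<in>insert 0 (fst w). keeps u i) (map (wipe_upd a) \<rho>s)"
    if "distinct \<rho>s" "set \<rho>s \<subseteq> set (reps a)" for \<rho>s
    using that
  proof (induction \<rho>s)
    case (Cons \<rho> \<rho>s)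
    have "\<forall>w\<in>set (map (wipe_upd a) \<rho>s). \<forall>i\<in>insert 0 (fst w). keeps (wipe_upd a \<rho>) i"
    proof (intro ballI)
      fix w i assume "w \<in> set (map (wipe_upd a) \<rho>s)" "i \<in> insert 0 (fst w)"
      then obtain \<rho>' where "\<rho>' \<in> set \<rho>s" "w = wipe_upd a \<rho>'" by auto
      with Cons.prems *[of \<rho> \<rho>' i] \<open>i \<in> insert 0 (fst w)\<close> show "keeps (wipe_upd a \<rho>) i" by auto
    qed
    with Cons show ?case by simp
  qed simp
  from this[OF distinct_reps] show ?thesis by (simp add: separated_def)
qed

text \<open>Exchanging the products over slots and variables counts, for each variable, the slots
  that carry it; this gives the capped digit, and the variable entries in
  \<open>even_factors\<close> restore a factor lost to the cap.\<close>

lemma prod_even_factors: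
  assumes "holds x e" "\<And>i. i < q \<Longrightarrow> e (slot i) = 0" "\<And>j. j < d \<Longrightarrow> a j < q"
  shows "prod (put (\<lambda>k. e k + stale x a A k) (plain a) A) (even_factors a) = A ^ q * (\<Prod>j<d. x j ^ a j)"
proof -
  let ?f = "put (\<lambda>k. e k + stale x a A k) (plain a) A"
  let ?J = "{..<d} - {j1}"
  have f0: "?f (slot i) = A * kind x a i" if "i < q" for i
    using assms(1) assms(2)[OF that] that
    by (auto simp: put_def plain_def stale_def holds_def special_def kind_def)
  have fj: "?f (Suc j) = x j" if "j < d" for j
    using assms(1) that by (auto simp: put_def plain_def stale_def holds_def)
  have "prod ?f (even_factors a) = prod ?f (slot ` {..<q}) * prod ?f (Suc ` {j. j < d \<and> a j = q - 1})"
    unfolding even_factors_def by (rule prod.union_disjoint) auto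
  also have "prod ?f (slot ` {..<q}) = (\<Prod>i<q. A * kind x a i)"
    by (subst prod.reindex[OF inj_slot]) (auto simp: f0)
  also have "\<dots> = A ^ q * ((\<Prod>i<q. \<Prod>j\<in>vars_at a i. x j) * (\<Prod>i<q. if marked a i then x j1 else 1))"
    by (simp add: kind_def prod.distrib)
  also have "(\<Prod>i<q. if marked a i then x j1 else 1) = (\<Prod>i\<in>{1..cap a j1}. x j1)"
    by (intro prod.mono_neutral_cong_right) (use q in \<open>auto simp: marked_def cap_def\<close>)
  also have "\<dots> = x j1 ^ cap a j1" by simp
  also have "(\<Prod>i<q. \<Prod>j\<in>vars_at a i. x j) = (\<Prod>i<q. \<Prod>j\<in>?J. if q - cap a j \<le> i then x j else 1)"
    by (intro prod.cong refl prod.mono_neutral_cong_left) (auto simp: vars_at_def)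
  also have "\<dots> = (\<Prod>j\<in>?J. \<Prod>i<q. if q - cap a j \<le> i then x j else 1)"
    by (rule prod.swap)
  also have "\<dots> = (\<Prod>j\<in>?J. x j ^ cap a j)"
  proof (intro prod.cong refl)
    fix j
    have "(\<Prod>i<q. if q - cap a j \<le> i then x j else 1) = (\<Prod>i\<in>{q - cap a j..<q}. x j)"
      by (intro prod.mono_neutral_cong_right) auto
    then show "(\<Prod>i<q. if q - cap a j \<le> i then x j else 1) = x j ^ cap a j"
      using q by (simp add: cap_def)
  qed
  also have "(\<Prod>j\<in>?J. x j ^ cap a j) * x j1 ^ cap a j1 = (\<Prod>j<d. x j ^ cap a j)"
    using j1 by (subst (2) prod.remove[of _ j1]) (auto simp: mult.commute)
  also have "prod ?f (Suc ` {j. j < d \<and> a j = q - 1}) = (\<Prod>j\<in>{j. j < d \<and> a j = q - 1}. x j)"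
    by (subst prod.reindex) (auto simp: fj)
  also have "\<dots> = (\<Prod>j<d. if a j = q - 1 then x j else 1)"
    by (intro prod.mono_neutral_cong_left) auto
  also have "A ^ q * (\<Prod>j<d. x j ^ cap a j) * (\<Prod>j<d. if a j = q - 1 then x j else 1)
      = A ^ q * (\<Prod>j<d. x j ^ cap a j * (if a j = q - 1 then x j else 1))"
    by (simp add: prod.distrib)
  also have "(\<Prod>j<d. x j ^ cap a j * (if a j = q - 1 then x j else 1)) = (\<Prod>j<d. x j ^ a j)"
  proof (intro prod.cong refl)
    fix j assume "j \<in> {..<d}"
    then have "a j < q" using assms(3) by simp
    then have "cap a j = a j \<and> a j \<noteq> q - 1 \<or> a j = Suc (cap a j) \<and> a j = q - 1"
      using q by (auto simp: cap_def)
    then show "x j ^ cap a j * (if a j = q - 1 then x j else 1) = x j ^ a j"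
      by auto
  qed
  finally show ?thesis .
qed

definition even_power :: "(nat \<Rightarrow> nat) \<Rightarrow> pattern \<Rightarrow> layer" where
  "even_power a D = power_layer (even_factors a) (slot 0) (plain a) D"

text \<open>The remains \<open>st\<close> of the previous level are erased by \<open>cl\<close> in
  the same packed sequence that fills the new products. The power layer removes only the plain
  copies, so the filled slots become the next remains.\<close>

lemma run_even_level:
  assumes "holds x e" "\<And>i. i < q \<Longrightarrow> e (slot i) = 0" "\<And>j. j < d \<Longrightarrow> a j < q"
    and st: "\<And>k. k \<le> d + 2 \<Longrightarrow> st k = 0"
    and cl: "separated cl" "\<And>u k. u \<in> set cl \<Longrightarrow> k \<le> d + 2 \<Longrightarrow> keeps u k"
      "\<And>k. (\<Sum>u\<leftarrow>cl. upd_val u (put (\<lambda>k. e k + st k) (plain a) A) k) = - st k"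
  shows "run (pairs (cl @ map (fill_upd a) (reps a)) @ [even_power a D]) (put (\<lambda>k. e k + st k) (plain a) A)
    = put (\<lambda>k. e k + stale x a A k) D (A ^ q * (\<Prod>j<d. x j ^ a j))"
proof -
  let ?f = "put (\<lambda>k. e k + st k) (plain a) A"
  have m0: "\<not> marked a 0" "0 \<notin> special a" using special_ge by (auto simp: marked_def)
  have s0: "slot 0 = d + 2" by (simp add: slot_def)
  have f0: "?f (slot 0) = A" using assms(2)[of 0] q st[of "slot 0"] m0
    by (simp add: put_def plain_def s0[symmetric]) (simp add: s0)
  have hf: "holds x ?f" using assms(1) st by (auto simp: put_def holds_def plain_def)
  have "run (pairs (cl @ map (fill_upd a) (reps a))) ?f = (\<lambda>k. ?f k - st k + stale x a A k)"
    by (rule ext) (simp add: run_pairs[OF separated_fill[OF cl(1,2)]] cl(3) sum_fill[OF hf f0, simplified])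
  also have "\<dots> = put (\<lambda>k. e k + stale x a A k) (plain a) A"
    using st by (auto simp: put_def stale_def)
  finally have "run (pairs (cl @ map (fill_upd a) (reps a)) @ [even_power a D]) ?f
     = run_layer (even_power a D) (put (\<lambda>k. e k + stale x a A k) (plain a) A)" by simp
  also have "\<dots> = put (\<lambda>k. e k + stale x a A k) D (prod (put (\<lambda>k. e k + stale x a A k) (plain a) A) (even_factors a))"
    unfolding even_power_def
    by (rule run_power_layer) (use q m0 assms(2) in \<open>auto simp: plain_def stale_def\<close>)
  finally show ?thesis by (simp add: prod_even_factors[OF assms(1-3)])
qed

lemma stale_low: "k \<le> d + 2 \<Longrightarrow> stale x a A k = 0"
  using special_ge[of 0 a] by (auto simp: stale_def on_slots_def)

lemma sum_wipe_put:
  assumes "holds x e" "\<And>i. i < q \<Longrightarrow> e (slot i) = 0" "fst D 0 = 0" "snd D 0 = 0"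
    and "\<And>\<rho>. \<rho> \<in> set (reps a) \<Longrightarrow> fst D (slot \<rho>) = 0 \<and> snd D (slot \<rho>) = 0"
  shows "(\<Sum>u\<leftarrow>map (wipe_upd a) (reps a). upd_val u (put (\<lambda>k. e k + stale x a A k) D A') k) = - stale x a A k"
proof (rule sum_wipe)
  show "put (\<lambda>k. e k + stale x a A k) D A' 0 = x j1"
    using assms by (simp add: put_def stale_low holds_def)
  fix \<rho> assume "\<rho> \<in> set (reps a)"
  then show "put (\<lambda>k. e k + stale x a A k) D A' (slot \<rho>) = A * kind x a \<rho>"
    using assms(2,5) rep_props[of \<rho> a] by (simp add: put_def stale_def)
qed

fun even_pat :: "nat \<Rightarrow> nat \<Rightarrow> pattern \<Rightarrow> pattern" where
  "even_pat 0 R D = D"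
| "even_pat (Suc n) R D = plain (digit (q ^ n * R) q)"

text \<open>The updates \<open>cl\<close> are the erasures due from the preceding level. The remains
  of the last level stay in place for a separate cleanup.\<close>

fun evens :: "upd list \<Rightarrow> nat \<Rightarrow> nat \<Rightarrow> pattern \<Rightarrow> layer list" where
  "evens cl 0 R D = []"
| "evens cl (Suc n) R D = (let a = digit (q ^ n * R) q in
     (pairs (cl @ map (fill_upd a) (reps a)) @ [even_power a (even_pat n R D)]) @
     evens (map (wipe_upd a) (reps a)) n R D)"

lemma digit_less: "r > 0 \<Longrightarrow> digit R r j < r"
  by (simp add: digit_def)

lemma last_rep:
  assumes "length (reps a) \<le> 1" "\<rho> \<in> set (reps a)"
  shows "\<rho> = q - 1"
proof -
  have "q - 1 \<in> special a" using q by (simp add: special_def)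
  then obtain \<rho>' where r: "\<rho>' \<in> set (reps a)" "q - 1 \<in> block a \<rho>'" by (rule rep_exists)
  then have "\<rho>' = q - 1" using rep_props[OF r(1)] by fastforce
  moreover have "\<rho> = \<rho>'" using assms r(1) by (cases "reps a") auto
  ultimately show ?thesis by simp
qed

text \<open>Above the lowest level a single block is required, because the next pattern is already
  in place when the remains are erased and must avoid their representatives. The lowest level may
  have several blocks.\<close>

lemma run_evens:
  assumes "holds x e" "\<And>i. i < q \<Longrightarrow> e (slot i) = 0" "n > 0"
    and "\<And>t. 1 \<le> t \<Longrightarrow> t < n \<Longrightarrow> length (reps (digit (q ^ t * R) q)) \<le> 1"
    and st: "\<And>k. k \<le> d + 2 \<Longrightarrow> st k = 0"
    and cl: "separated cl" "\<And>u k. u \<in> set cl \<Longrightarrow> k \<le> d + 2 \<Longrightarrow> keeps u k"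
      "\<And>k. (\<Sum>u\<leftarrow>cl. upd_val u (put (\<lambda>k. e k + st k) (even_pat n R D) (monomial x (q ^ n * R))) k) = - st k"
  shows "run (evens cl n R D) (put (\<lambda>k. e k + st k) (even_pat n R D) (monomial x (q ^ n * R)))
    = put (\<lambda>k. e k + stale x (digit R q) (monomial x (q * R)) k) D (monomial x R)"
  using assms(3-)
proof (induction n arbitrary: cl st)
  case (Suc n)
  let ?a = "digit (q ^ n * R) q"
  let ?A = "monomial x (q ^ Suc n * R)"
  have a: "\<And>j. j < d \<Longrightarrow> ?a j < q" using q by (simp add: digit_less)
  have pat: "even_pat (Suc n) R D = plain ?a" by simp
  have step: "run (pairs (cl @ map (fill_upd ?a) (reps ?a)) @ [even_power ?a (even_pat n R D)])
      (put (\<lambda>k. e k + st k) (plain ?a) ?A)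
    = put (\<lambda>k. e k + stale x ?a ?A k) (even_pat n R D) (monomial x (q ^ n * R))"
    using run_even_level[OF assms(1,2) a Suc.prems(3-5) Suc.prems(6)[unfolded pat], of "even_pat n R D"]
      monomial_step[of x q "q ^ n * R"] by (simp add: mult.assoc)
  show ?case
  proof (cases n)
    case 0
    with step show ?thesis by (simp add: Let_def)
  next
    case (Suc m)
    have len: "length (reps ?a) \<le> 1" using Suc Suc.prems by (intro Suc.prems(2)) auto
    let ?b = "digit (q ^ m * R) q"
    have patn: "even_pat n R D = plain ?b" by (simp add: Suc)
    have qs: "q - 1 \<in> special ?b" using q by (simp add: special_def)
    have "run (evens (map (wipe_upd ?a) (reps ?a)) n R D)
        (put (\<lambda>k. e k + stale x ?a ?A k) (even_pat n R D) (monomial x (q ^ n * R)))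
      = put (\<lambda>k. e k + stale x (digit R q) (monomial x (q * R)) k) D (monomial x R)"
    proof (rule Suc.IH)
      show "n > 0" using Suc by simp
      show "\<And>t. 1 \<le> t \<Longrightarrow> t < n \<Longrightarrow> length (reps (digit (q ^ t * R) q)) \<le> 1"
        using Suc.prems(2) by simp
      show "\<And>k. k \<le> d + 2 \<Longrightarrow> stale x ?a ?A k = 0" by (rule stale_low)
      show "separated (map (wipe_upd ?a) (reps ?a))" by (rule separated_wipe)
      show "\<And>u k. u \<in> set (map (wipe_upd ?a) (reps ?a)) \<Longrightarrow> k \<le> d + 2 \<Longrightarrow> keeps u k"
        using wipe_keeps by auto
      \<comment> \<open>The only representative is slot \<open>q - 1\<close>, which is special for
        the next digits as well.\<close>
      show "(\<Sum>u\<leftarrow>map (wipe_upd ?a) (reps ?a). upd_val u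
          (put (\<lambda>k. e k + stale x ?a ?A k) (even_pat n R D) (monomial x (q ^ n * R))) k) = - stale x ?a ?A k" for k
        by (rule sum_wipe_put[OF assms(1,2)])
          (use last_rep[OF len] qs in \<open>auto simp: patn plain_def\<close>)
    qed
    with step show ?thesis by (simp add: Let_def)
  qed
qed simp

lemma even_updates_within:
  assumes "p = d + 2 + q"
  shows "upd_within p (fill_upd a \<rho>)" "\<rho> < q \<Longrightarrow> upd_within p (wipe_upd a \<rho>)" "layer_within p (even_power a D)"
  using q by (auto simp: assms fill_upd_def wipe_upd_def even_power_def power_layer_def layer_within_def
      even_factors_def slot_def vars_at_def)

lemma evens_within:
  assumes "p = d + 2 + q"
  shows "\<forall>u\<in>set cl. upd_within p u \<Longrightarrow> \<forall>l\<in>set (evens cl n R D). layer_within p l"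
proof (induction n arbitrary: cl)
  case (Suc n)
  let ?a = "digit (q ^ n * R) q"
  have "\<forall>l\<in>set (pairs (cl @ map (fill_upd ?a) (reps ?a))). layer_within p l"
    by (rule pairs_within) (use Suc.prems even_updates_within(1)[OF assms] in auto)
  moreover have "\<forall>l\<in>set (evens (map (wipe_upd ?a) (reps ?a)) n R D). layer_within p l"
    by (rule Suc.IH) (use even_updates_within(2)[OF assms] rep_props(2) in auto)
  ultimately show ?case using even_updates_within(3)[OF assms] by (auto simp: Let_def)
qed simp

text \<open>Each level above the lowest packs at most one erasure and one fill into one layer and
  adds a power layer. On the lowest level at most one erasure is packed with all fills.\<close>

lemma length_evens:
  assumes "length cl \<le> 1" "n > 0"
    and "\<And>t. 1 \<le> t \<Longrightarrow> t < n \<Longrightarrow> length (reps (digit (q ^ t * R) q)) \<le> 1"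
  shows "length (evens cl n R D) \<le> 2 * n + length (reps (digit R q)) div 2"
  using assms
proof (induction n arbitrary: cl)
  case (Suc n)
  let ?a = "digit (q ^ n * R) q"
  show ?case
  proof (cases n)
    case 0
    with Suc.prems show ?thesis by (simp add: length_pairs Let_def)
  next
    case (Suc m)
    have len: "length (reps ?a) \<le> 1" using Suc Suc.prems by (intro Suc.prems(3)) auto
    then have "length (evens (map (wipe_upd ?a) (reps ?a)) n R D) \<le> 2 * n + length (reps (digit R q)) div 2"
      by (intro Suc.IH) (use Suc Suc.prems(3) in auto)
    moreover have "Suc (length cl + length (reps ?a)) div 2 \<le> 1"
      using len Suc.prems(1) by linarith
    ultimately show ?thesis by (simp add: length_pairs Let_def)
  qed
qed simp

text \<open>A nested product is determined by its largest threshold \<open>q - cap a j\<close>, and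
  every threshold belongs to a variable in \<open>V\<close>. The maximum with 1 covers the last
  slot, which is special even without a product.\<close>

lemma length_reps:
  assumes "finite V" "\<And>j. j < d \<Longrightarrow> j \<noteq> j1 \<Longrightarrow> a j \<noteq> 0 \<Longrightarrow> j \<in> V"
  shows "length (reps a) \<le> max 1 (card V)"
proof (cases "\<exists>i<q. vars_at a i \<noteq> {}")
  case True
  then have ne: "vars_at a i \<noteq> {}" if "i \<in> special a" for i
    using that by (auto simp: special_def vars_at_def)
  define g where "g i = Max ((\<lambda>j. q - cap a j) ` vars_at a i)" for i
  have g_eq: "vars_at a i = {j. j < d \<and> j \<noteq> j1 \<and> q - cap a j \<le> g i}" if "i \<in> special a" for i
  proof -
    have fin: "finite ((\<lambda>j. q - cap a j) ` vars_at a i)" by simp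
    have "g i \<le> i" unfolding g_def using ne[OF that] by (subst Max_le_iff) (auto simp: vars_at_def)
    moreover have "q - cap a j \<le> g i" if "j \<in> vars_at a i" for j
      unfolding g_def using that fin by (intro Max_ge) auto
    ultimately show ?thesis unfolding vars_at_def by auto
  qed
  have "inj_on g (set (reps a))"
  proof (rule inj_onI)
    fix \<rho> \<rho>' assume r: "\<rho> \<in> set (reps a)" "\<rho>' \<in> set (reps a)" "g \<rho> = g \<rho>'"
    then have "vars_at a \<rho> = vars_at a \<rho>'" using g_eq[OF rep_props(1)[OF r(1)]] g_eq[OF rep_props(1)[OF r(2)]] by simp
    then have "\<rho> \<in> block a \<rho>'" using rep_props(1)[OF r(1)] by (simp add: block_def)
    then show "\<rho> = \<rho>'" using rep_unique[OF r(1,2)] rep_props(3)[OF r(1)] by blast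
  qed
  then have "card (set (reps a)) = card (g ` set (reps a))" by (simp add: card_image)
  moreover have "g ` set (reps a) \<subseteq> (\<lambda>j. q - cap a j) ` V"
  proof
    fix y assume "y \<in> g ` set (reps a)"
    then obtain \<rho> where r: "\<rho> \<in> set (reps a)" "y = g \<rho>" by auto
    have "g \<rho> \<in> (\<lambda>j. q - cap a j) ` vars_at a \<rho>"
      unfolding g_def using ne rep_props(1)[OF r(1)] by (intro Max_in) auto
    then obtain j where j: "j \<in> vars_at a \<rho>" "g \<rho> = q - cap a j" by auto
    then have "a j \<noteq> 0" using rep_props(2)[OF r(1)] by (auto simp: vars_at_def cap_def)
    with j assms(2) r(2) show "y \<in> (\<lambda>j. q - cap a j) ` V" by (auto simp: vars_at_def)
  qed
  then have "card (g ` set (reps a)) \<le> card ((\<lambda>j. q - cap a j) ` V)"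
    by (intro card_mono) (use assms(1) in auto)
  moreover have "card ((\<lambda>j. q - cap a j) ` V) \<le> card V"
    using assms(1) by (rule card_image_le)
  ultimately have "card (set (reps a)) \<le> card V" by linarith
  then show ?thesis by (simp add: distinct_card[OF distinct_reps])
next
  case False
  then have "special a \<subseteq> {q - 1}" by (auto simp: special_def)
  then have "set (reps a) \<subseteq> {q - 1}" using rep_props(1) by blast
  from card_mono[OF _ this] show ?thesis by (simp add: distinct_card[OF distinct_reps])
qed

section \<open>Programs for one monomial\<close>

definition final_pat :: "real \<Rightarrow> pattern" where
  "final_pat C = ((\<lambda>k. if k = Suc d then C else 0), (\<lambda>_. 0))"

text \<open>The accumulator is correct already after \<open>core\<close>, so the cleanup can be
  skipped after the last monomial. The cleanup restores the slots; entry 0 is overwritten by the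
  next initial layer.\<close>

definition computes :: "real \<Rightarrow> layer list \<Rightarrow> layer list \<Rightarrow> bool" where
  "computes C core cleanup \<longleftrightarrow> (\<forall>x f. (\<forall>j<d. f (Suc j) = x j) \<and> (\<forall>i<q. f (slot i) = 0) \<longrightarrow>
     run core f (Suc d) = f (Suc d) + C * monomial x 1 \<and>
     run (core @ cleanup) f = f(0 := x j1, Suc d := f (Suc d) + C * monomial x 1))"

lemma put_final: "put e (final_pat C) A = e(Suc d := e (Suc d) + C * A)"
  by (auto simp: put_def final_pat_def)

lemma pattern_at_0 [simp]:
  "fst (pat r b) 0 = 0" "snd (pat r b) 0 = 0" "fst (plain a) 0 = 0" "snd (plain a) 0 = 0"
  "fst (final_pat C) 0 = 0" "snd (final_pat C) 0 = 0"
  by (auto simp: pat_def plain_def final_pat_def)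

lemma first_pat_at_0 [simp]:
  "fst D 0 = 0 \<Longrightarrow> fst (first_pat rs R D) 0 = 0" "snd D 0 = 0 \<Longrightarrow> snd (first_pat rs R D) 0 = 0"
  by (cases rs; simp)+

lemma even_pat_at_0 [simp]:
  "fst D 0 = 0 \<Longrightarrow> fst (even_pat n R D) 0 = 0" "snd D 0 = 0 \<Longrightarrow> snd (even_pat n R D) 0 = 0"
  by (cases n; simp)+

text \<open>Above all exponents Horner's rule starts from 1, the value that
  \<open>init_layer\<close> writes.\<close>

lemma monomial_1:
  assumes "\<And>j. j < d \<Longrightarrow> \<alpha> j < R"
  shows "monomial x R = 1"
  using assms by (simp add: monomial_def)

lemma init_layer_within:
  assumes "p = d + 2 + q" shows "layer_within p (init_layer j1 P)"
  using j1 by (simp add: init_layer_def layer_within_def assms)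

text \<open>
  Copy 0 of \<open>x\<^sub>j\<close> is the entry of the variable; the variables in \<open>vs\<close> have \<open>w\<close> further copies each, in
  consecutive slots from \<open>b\<close> on.
\<close>

definition copies :: "nat \<Rightarrow> nat \<Rightarrow> nat list \<Rightarrow> nat \<Rightarrow> nat \<Rightarrow> nat" where
  "copies b w vs j s = (if s = 0 then Suc j else slot (b + (SOME t. t < length vs \<and> vs ! t = j) * w + (s - 1)))"

lemma copies_pos:
  assumes "j \<in> set vs"
  obtains t where "t < length vs" "vs ! t = j" "\<And>s. s \<noteq> 0 \<Longrightarrow> copies b w vs j s = slot (b + t * w + (s - 1))"
proof -
  let ?t = "SOME t. t < length vs \<and> vs ! t = j"
  have "?t < length vs \<and> vs ! ?t = j"
    by (rule someI_ex) (use assms in \<open>auto simp: in_set_conv_nth\<close>)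
  then show ?thesis by (intro that[of ?t]) (auto simp: copies_def)
qed

text \<open>The further copies lie beyond the \<open>r\<close> working slots, and division by
  \<open>w\<close> recovers the list position from a slot, which yields injectivity.\<close>

lemma supplies_copies:
  assumes "holds x e" "r \<le> b \<or> vs = []"
    and dig: "\<And>j. j < d \<Longrightarrow> j \<noteq> j1 \<Longrightarrow> a j \<le> (if j \<in> set vs then Suc w else 1)"
    and tab: "\<And>t s. t < length vs \<Longrightarrow> s < w \<Longrightarrow> e (slot (b + t * w + s)) = x (vs ! t)"
  shows "supplies (copies b w vs) e x r a"
  unfolding supplies_def
proof (intro conjI ballI allI impI)
  have ex: "j \<in> set vs \<and> s - 1 < w" if "j < d" "j \<noteq> j1" "s < a j" "s \<noteq> 0" for j s
    using dig[OF that(1,2)] that by (auto split: if_splits)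
  fix j s assume js: "j \<in> {..<d} - {j1}" "s < a j"
  have "copies b w vs j s \<notin> slot ` {..<r} \<and> e (copies b w vs j s) = x j"
  proof (cases "s = 0")
    case True
    with assms(1) js show ?thesis by (auto simp: copies_def holds_def)
  next
    case False
    then have j: "j \<in> set vs" "s - 1 < w" using ex js by auto
    then obtain t where t: "t < length vs" "vs ! t = j" "copies b w vs j s = slot (b + t * w + (s - 1))"
      using False copies_pos[of j vs b w] by metis
    have "vs \<noteq> []" using j by auto
    then have "r \<le> b" using assms(2) by simp
    with t tab[OF t(1) j(2)] show ?thesis by auto
  qed
  then show "copies b w vs j s \<notin> slot ` {..<r}" "e (copies b w vs j s) = x j" by auto
next
  have ex: "j \<in> set vs \<and> s - 1 < w" if "j < d" "j \<noteq> j1" "s < a j" "s \<noteq> 0" for j s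
    using dig[OF that(1,2)] that by (auto split: if_splits)
  have "j = j' \<and> s = s'"
    if "j < d" "j \<noteq> j1" "s < a j" "j' < d" "j' \<noteq> j1" "s' < a j'" "copies b w vs j s = copies b w vs j' s'"
    for j s j' s'
  proof (cases "s = 0 \<or> s' = 0")
    case True
    with that show ?thesis by (auto simp: copies_def split: if_splits)
  next
    case False
    then have m: "j \<in> set vs" "s - 1 < w" "j' \<in> set vs" "s' - 1 < w" using ex that by auto
    obtain t where t: "vs ! t = j" "copies b w vs j s = slot (b + t * w + (s - 1))"
      using False copies_pos[OF m(1), of b w] by metis
    obtain t' where t': "vs ! t' = j'" "copies b w vs j' s' = slot (b + t' * w + (s' - 1))"
      using False copies_pos[OF m(3), of b w] by metis
    have eq: "t * w + (s - 1) = t' * w + (s' - 1)" using that(7) t t' by simp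
    have "t = (t * w + (s - 1)) div w" "t' = (t' * w + (s' - 1)) div w" using m by auto
    with eq have "t = t'" by metis
    with eq have "s - 1 = s' - 1" by simp
    with False have "s = s'" by arith
    with \<open>t = t'\<close> t(1) t'(1) show ?thesis by simp
  qed
  then show "inj_on (\<lambda>(j, s). copies b w vs j s) (SIGMA j:{..<d} - {j1}. {..<a j})"
    by (auto simp: inj_on_def)
qed

lemma copies_within:
  assumes "p = d + 2 + q" "j < d" "s < a" "a \<le> (if j \<in> set vs then Suc w else 1)" "b + length vs * w \<le> q"
  shows "copies b w vs j s \<in> {1..<p}"
proof (cases "s = 0")
  case True
  with assms show ?thesis by (simp add: copies_def)
next
  case False
  with assms(3,4) have j: "j \<in> set vs" "s - 1 < w" by (auto split: if_splits)
  obtain t where t: "t < length vs" "copies b w vs j s = slot (b + t * w + (s - 1))"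
    using False copies_pos[OF j(1), of b w] by metis
  have "t * w + (s - 1) < Suc t * w" using j(2) by simp
  also have "\<dots> \<le> length vs * w" using t(1) by (intro mult_right_mono) auto
  finally show ?thesis using t(2) assms(1,5) by (simp add: slot_def)
qed

lemma run_start:
  assumes "\<forall>j<d. f (Suc j) = x j" "\<forall>i<q. f (slot i) = 0" "fst P 0 = 0" "snd P 0 = 0"
  shows "run_layer (init_layer j1 P) f = put (f(0 := x j1)) P 1"
    and "holds x (f(0 := x j1))" "\<And>i. i < q \<Longrightarrow> (f(0 := x j1)) (slot i) = 0"
  using assms j1 by (simp_all add: run_init_layer holds_def)

text \<open>Here all digits except those of \<open>x j1\<close> vanish, so the pattern alone
  supplies the factors.\<close>

lemma run_head:
  assumes e: "holds x e" "\<And>i. i < q \<Longrightarrow> e (slot i) = 0"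
    and small: "\<And>j. j < d \<Longrightarrow> j \<noteq> j1 \<Longrightarrow> \<alpha> j < R"
  shows "run (horner (copies 0 0 []) (replicate E q) R D) (put e (first_pat (replicate E q) R D) (monomial x (q ^ E * R)))
    = put e D (monomial x R)"
proof -
  have "run (horner (copies 0 0 []) (replicate E q) R D)
      (put e (first_pat (replicate E q) R D) (monomial x (prod_list (replicate E q) * R))) = put e D (monomial x R)"
  proof (rule run_horner[OF e(1)])
    fix us r vs assume "replicate E q = us @ r # vs"
    then obtain t where t: "r = q" "vs = replicate t q"
      using replicate_append_eq[of E q "[]" us r vs] by auto
    have "digit (prod_list vs * R) r j = 0" if "j < d" "j \<noteq> j1" for j
    proof -
      have "\<alpha> j < R" by (rule small[OF that])
      also have "R \<le> q ^ t * R" using q by simp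
      finally show ?thesis by (simp add: digit_def t)
    qed
    then show "r > 0 \<and> supplies (copies 0 0 []) e x r (digit (prod_list vs * R) r) \<and> (\<forall>i<r. e (slot i) = 0)"
      using q e by (auto simp: t intro!: supplies_copies)
  qed
  then show ?thesis by simp
qed

text \<open>A binary digit is at most 1, so the variable entries suffice as copies. Only slots 0 and
  1 have to be free; other slots may hold remains.\<close>

lemma run_tail:
  assumes "holds x e" "e (slot 0) = 0" "e (slot 1) = 0"
  shows "run (horner (copies 0 0 []) (replicate n 2) R D) (put e (first_pat (replicate n 2) R D) (monomial x (2 ^ n * R)))
    = put e D (monomial x R)"
proof -
  have "run (horner (copies 0 0 []) (replicate n 2) R D)
      (put e (first_pat (replicate n 2) R D) (monomial x (prod_list (replicate n 2) * R))) = put e D (monomial x R)"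
  proof (rule run_horner[OF assms(1)])
    fix us r vs assume "replicate n (2 :: nat) = us @ r # vs"
    then have r: "r = 2" using replicate_append_eq[of n 2 "[]" us r vs] by auto
    have "digit (prod_list vs * R) r j \<le> 1" for j using digit_less[of r "prod_list vs * R" j] r by simp
    then show "r > 0 \<and> supplies (copies 0 0 []) e x r (digit (prod_list vs * R) r) \<and> (\<forall>i<r. e (slot i) = 0)"
      using assms by (auto simp: r less_2_cases_iff intro!: supplies_copies)
  qed
  then show ?thesis by simp
qed

lemma horner_replicate_within:
  assumes "p = d + 2 + q" "r \<le> q" "r > 0" "r \<noteq> 2 \<Longrightarrow> (\<And>j. j < d \<Longrightarrow> j \<noteq> j1 \<Longrightarrow> \<alpha> j < R)"
  shows "\<forall>l\<in>set (horner (copies 0 0 []) (replicate n r) R D). layer_within p l"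
proof (rule horner_within[OF assms(1)])
  show "\<And>r'. r' \<in> set (replicate n r) \<Longrightarrow> r' \<le> q" using assms(2) by auto
  fix us r' vs j s
  assume "replicate n r = us @ r' # vs" and js: "j < d" "j \<noteq> j1" "s < digit (prod_list vs * R) r' j"
  then obtain t where t: "r' = r" "vs = replicate t r"
    using replicate_append_eq[of n r "[]" us r' vs] by auto
  have "digit (prod_list vs * R) r' j \<le> 1"
  proof (cases "r = 2")
    case True
    then show ?thesis using digit_less[of r "prod_list vs * R" j] t by simp
  next
    case False
    have "\<alpha> j < R" by (rule assms(4)[OF False js(1,2)])
    also have "R \<le> r ^ t * R" using assms(3) by simp
    finally show ?thesis by (simp add: digit_def t)
  qed
  then show "copies 0 0 [] j s \<in> {1..<p}"
    by (intro copies_within[OF assms(1) js(1,3)]) auto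
qed

section \<open>Programs with base-\<open>q\<close> levels of one variable and binary levels\<close>

definition simple_core :: "real \<Rightarrow> nat \<Rightarrow> nat \<Rightarrow> layer list" where
  "simple_core C E n = (let P = first_pat (replicate n 2) 1 (final_pat C) in
     init_layer j1 (first_pat (replicate E q) (2 ^ n) P) #
     horner (copies 0 0 []) (replicate E q) (2 ^ n) P @
     horner (copies 0 0 []) (replicate n 2) 1 (final_pat C))"

lemma simple_core:
  assumes "\<And>j. j < d \<Longrightarrow> \<alpha> j < q ^ E * 2 ^ n" "\<And>j. j < d \<Longrightarrow> j \<noteq> j1 \<Longrightarrow> \<alpha> j < 2 ^ n"
  shows "computes C (simple_core C E n) []" "length (simple_core C E n) = 1 + E + n"
    "\<forall>l\<in>set (simple_core C E n). layer_within (d + 2 + q) l"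
proof -
  show "computes C (simple_core C E n) []"
    unfolding computes_def
  proof (intro allI impI, elim conjE)
    fix x f :: "nat \<Rightarrow> real" assume f: "\<forall>j<d. f (Suc j) = x j" "\<forall>i<q. f (slot i) = 0"
    let ?P = "first_pat (replicate n 2) 1 (final_pat C)"
    define e where "e = f(0 := x j1)"
    note start = run_start[OF f, of "first_pat (replicate E q) (2 ^ n) ?P", folded e_def]
    have e: "holds x e" "\<And>i. i < q \<Longrightarrow> e (slot i) = 0"
      using start by auto
    have "run (simple_core C E n) f = put e (final_pat C) (monomial x 1)"
      using start(1) run_head[OF e assms(2), of E ?P] run_tail[OF e(1), of n 1 "final_pat C"] e(2)[of 0] e(2)[of 1] q
        monomial_1[OF assms(1), of x]
      by (simp add: simple_core_def Let_def)
    then have "run (simple_core C E n) f = f(0 := x j1, Suc d := f (Suc d) + C * monomial x 1)"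
      by (simp add: put_final e_def)
    then show "run (simple_core C E n) f (Suc d) = f (Suc d) + C * monomial x 1 \<and>
      run (simple_core C E n @ []) f = f(0 := x j1, Suc d := f (Suc d) + C * monomial x 1)" by simp
  qed
  show "length (simple_core C E n) = 1 + E + n" by (simp add: simple_core_def Let_def)
  show "\<forall>l\<in>set (simple_core C E n). layer_within (d + 2 + q) l"
    using horner_replicate_within[OF refl _ _ assms(2), of q E] horner_replicate_within[OF refl, of 2 1 n] q
      init_layer_within
    unfolding simple_core_def Let_def list_all_iff[symmetric] by simp
qed

section \<open>Programs with nested products of variables\<close>

definition even_core :: "real \<Rightarrow> nat \<Rightarrow> nat \<Rightarrow> nat \<Rightarrow> layer list" where
  "even_core C E k n = (let P = first_pat (replicate n 2) 1 (final_pat C); P' = even_pat k (2 ^ n) P in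
     init_layer j1 (first_pat (replicate E q) (q ^ k * 2 ^ n) P') #
     horner (copies 0 0 []) (replicate E q) (q ^ k * 2 ^ n) P' @
     evens [] k (2 ^ n) P @
     horner (copies 0 0 []) (replicate n 2) 1 (final_pat C))"

definition even_cleanup :: "nat \<Rightarrow> layer list" where
  "even_cleanup n = pairs (map (wipe_upd (digit (2 ^ n) q)) (reps (digit (2 ^ n) q)))"

lemma special_ge_2: "q \<ge> 3 \<Longrightarrow> i \<in> special a \<Longrightarrow> i \<ge> 2"
  by (auto simp: special_def vars_at_def cap_def)

text \<open>For \<open>q \<ge> 3\<close> slots 0 and 1 are never special, so the binary levels can
  run beside the remains of the lowest base-\<open>q\<close> level, which the cleanup
  erases.\<close>

lemma even_core:
  assumes "q \<ge> 3" "k > 0"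
    and "\<And>j. j < d \<Longrightarrow> \<alpha> j < q ^ E * (q ^ k * 2 ^ n)" "\<And>j. j < d \<Longrightarrow> j \<noteq> j1 \<Longrightarrow> \<alpha> j < q ^ k * 2 ^ n"
    and one: "\<And>t. 1 \<le> t \<Longrightarrow> t < k \<Longrightarrow> length (reps (digit (q ^ t * 2 ^ n) q)) \<le> 1"
  shows "computes C (even_core C E k n) (even_cleanup n)"
    "length (even_core C E k n) \<le> 1 + E + (2 * k + length (reps (digit (2 ^ n) q)) div 2) + n"
    "length (even_cleanup n) = Suc (length (reps (digit (2 ^ n) q))) div 2"
    "\<forall>l\<in>set (even_core C E k n @ even_cleanup n). layer_within (d + 2 + q) l"
proof -
  let ?P = "first_pat (replicate n 2) 1 (final_pat C)" and ?a = "digit (2 ^ n) q"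
  let ?P' = "even_pat k (2 ^ n) ?P"
  show "computes C (even_core C E k n) (even_cleanup n)"
    unfolding computes_def
  proof (intro allI impI, elim conjE)
    fix x f :: "nat \<Rightarrow> real" assume f: "\<forall>j<d. f (Suc j) = x j" "\<forall>i<q. f (slot i) = 0"
    define e where "e = f(0 := x j1)"
    note start = run_start[OF f, of "first_pat (replicate E q) (q ^ k * 2 ^ n) ?P'", folded e_def]
    have e: "holds x e" "\<And>i. i < q \<Longrightarrow> e (slot i) = 0"
      using start by auto
    define st where "st = stale x ?a (monomial x (q * 2 ^ n))"
    define e' where "e' = (\<lambda>k. e k + st k)"
    have "run (evens [] k (2 ^ n) ?P) (put (\<lambda>k. e k + 0) ?P' (monomial x (q ^ k * 2 ^ n)))
       = put e' ?P (monomial x (2 ^ n))"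
      unfolding e'_def st_def
      by (rule run_evens[OF e assms(2) one]) (auto simp: separated_def)
    moreover have h: "holds x e'"
      using e(1) by (auto simp: e'_def st_def holds_def stale_low)
    moreover have "e' (slot 0) = 0" "e' (slot 1) = 0"
      using e(2)[of 0] e(2)[of 1] q special_ge_2[OF assms(1)] by (fastforce simp: e'_def st_def stale_def)+
    ultimately have main: "run (even_core C E k n) f = put e' (final_pat C) (monomial x 1)"
      using start(1) run_head[OF e assms(4), of E ?P'] run_tail[OF h, of n 1 "final_pat C"] monomial_1[OF assms(3), of x]
      by (simp add: even_core_def Let_def)
    have "run (even_cleanup n) (put e' (final_pat C) (monomial x 1)) = put e (final_pat C) (monomial x 1)"
    proof (rule ext)
      fix i
      have "(\<Sum>u\<leftarrow>map (wipe_upd ?a) (reps ?a). upd_val u (put e' (final_pat C) (monomial x 1)) i) = - st i"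
        unfolding e'_def st_def
        by (rule sum_wipe_put[OF e]) (auto simp: final_pat_def slot_def)
      then show "run (even_cleanup n) (put e' (final_pat C) (monomial x 1)) i = put e (final_pat C) (monomial x 1) i"
        unfolding even_cleanup_def run_pairs[OF separated_wipe]
        by (simp add: put_def e'_def final_pat_def)
    qed
    moreover have "e' (Suc d) = f (Suc d)" by (simp add: e'_def st_def stale_low e_def)
    ultimately show "run (even_core C E k n) f (Suc d) = f (Suc d) + C * monomial x 1 \<and>
      run (even_core C E k n @ even_cleanup n) f = f(0 := x j1, Suc d := f (Suc d) + C * monomial x 1)"
      by (simp add: main put_final) (simp add: e_def)
  qed
  show "length (even_core C E k n) \<le> 1 + E + (2 * k + length (reps ?a) div 2) + n"
    using length_evens[of "[]" k "2 ^ n" ?P] one assms(2) by (simp add: even_core_def Let_def)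
  show "length (even_cleanup n) = Suc (length (reps ?a)) div 2"
    by (simp add: even_cleanup_def length_pairs)
  have "\<forall>l\<in>set (even_cleanup n). layer_within (d + 2 + q) l"
    unfolding even_cleanup_def by (rule pairs_within) (use even_updates_within(2)[OF refl] rep_props(2) in auto)
  then show "\<forall>l\<in>set (even_core C E k n @ even_cleanup n). layer_within (d + 2 + q) l"
    using horner_replicate_within[OF refl _ _ assms(4), of q E] horner_replicate_within[OF refl, of 2 1 n] q
      init_layer_within evens_within[OF refl, of "[]"]
    unfolding even_core_def Let_def list_all_iff[symmetric] by simp
qed

section \<open>Programs with tables of copies\<close>

definition load_upd :: "real \<Rightarrow> nat \<Rightarrow> nat \<Rightarrow> nat list \<Rightarrow> nat \<Rightarrow> upd" where
  "load_upd c b w vs t = ({Suc (vs ! t)}, on_slots (\<lambda>i. c * of_bool (b \<le> i \<and> (i - b) div w = t)), (\<lambda>_. 0))"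

definition loads :: "real \<Rightarrow> nat \<Rightarrow> nat \<Rightarrow> nat list \<Rightarrow> layer list" where
  "loads c b w vs = pairs (map (load_upd c b w vs) [0..<length vs])"

definition table :: "(nat \<Rightarrow> real) \<Rightarrow> nat \<Rightarrow> nat \<Rightarrow> nat list \<Rightarrow> nat \<Rightarrow> real" where
  "table x b w vs = on_slots (\<lambda>i. if b \<le> i \<and> (i - b) div w < length vs then x (vs ! ((i - b) div w)) else 0)"

lemma run_loads:
  assumes "\<forall>j\<in>set vs. j < d \<and> f (Suc j) = x j"
  shows "run (loads c b w vs) f = (\<lambda>k. f k + c * table x b w vs k)"
proof -
  have sep: "separated (map (load_upd c b w vs) [0..<length vs])"
    unfolding separated_def sorted_wrt_iff_nth_less
  proof (intro allI impI ballI)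
    fix s t i
    assume st: "s < t" "t < length (map (load_upd c b w vs) [0..<length vs])"
      and i: "i \<in> insert 0 (fst (map (load_upd c b w vs) [0..<length vs] ! t))"
    have "vs ! t < d" using assms st by simp
    with st i show "keeps (map (load_upd c b w vs) [0..<length vs] ! s) i"
      by (auto simp: load_upd_def)
  qed
  have "(\<Sum>u\<leftarrow>map (load_upd c b w vs) [0..<length vs]. upd_val u f k) = c * table x b w vs k" for k
  proof (cases "d + 2 \<le> k")
    case True
    define i where "i = k - (d + 2)"
    have k: "k = slot i" using True by (simp add: i_def slot_def)
    have val: "upd_val (load_upd c b w vs t) f k = (if (i - b) div w = t then (if b \<le> i then c * x (vs ! t) else 0) else 0)"
      if "t < length vs" for t
      using assms that by (auto simp: load_upd_def k)
    have "(\<Sum>u\<leftarrow>map (load_upd c b w vs) [0..<length vs]. upd_val u f k) = (\<Sum>t<length vs. upd_val (load_upd c b w vs t) f k)"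
      by (simp add: comp_def interv_sum_list_conv_sum_set_nat atLeast0LessThan)
    also have "\<dots> = (\<Sum>t<length vs. if (i - b) div w = t then (if b \<le> i then c * x (vs ! t) else 0) else 0)"
      by (intro sum.cong refl val) simp
    also have "\<dots> = c * table x b w vs k" by (simp add: k table_def)
    finally show ?thesis .
  next
    case False
    then have "on_slots g k = 0" for g by (simp add: on_slots_def)
    then show ?thesis by (simp add: load_upd_def table_def comp_def)
  qed
  then show ?thesis unfolding loads_def by (intro ext) (simp only: run_pairs[OF sep])
qed

text \<open>The tables are loaded after the base-\<open>q\<close> levels, which occupy all slots. A
  digit in radix \<open>b\<close> is at most \<open>b - 1\<close>: one factor is the variable entry,
  and the table supplies \<open>b - 2\<close> more.\<close>

definition table_core :: "real \<Rightarrow> nat \<Rightarrow> nat \<Rightarrow> nat \<Rightarrow> nat list \<Rightarrow> nat \<Rightarrow> layer list" where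
  "table_core C E k b vs n = (let rs = replicate k b @ replicate n 2; P = first_pat rs 1 (final_pat C) in
     init_layer j1 (first_pat (replicate E q) (b ^ k * 2 ^ n) P) #
     horner (copies 0 0 []) (replicate E q) (b ^ k * 2 ^ n) P @
     loads 1 b (b - 2) vs @
     horner (copies b (b - 2) vs) rs 1 (final_pat C))"

lemma table_core:
  assumes b: "b \<ge> 3" "b + length vs * (b - 2) \<le> q" and vs: "\<forall>j\<in>set vs. j < d"
    and a1: "\<And>j. j < d \<Longrightarrow> \<alpha> j < q ^ E * (b ^ k * 2 ^ n)" and a2: "\<And>j. j < d \<Longrightarrow> j \<noteq> j1 \<Longrightarrow> \<alpha> j < b ^ k * 2 ^ n"
    and a3: "\<And>j. j < d \<Longrightarrow> j \<noteq> j1 \<Longrightarrow> j \<notin> set vs \<Longrightarrow> \<alpha> j < 2 ^ n"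
  shows "computes C (table_core C E k b vs n) (loads (-1) b (b - 2) vs)"
    "length (table_core C E k b vs n) = 1 + E + Suc (length vs) div 2 + k + n"
    "length (loads (-1) b (b - 2) vs) = Suc (length vs) div 2"
    "\<forall>l\<in>set (table_core C E k b vs n @ loads (-1) b (b - 2) vs). layer_within (d + 2 + q) l"
proof -
  let ?rs = "replicate k b @ replicate n 2"
  let ?P = "first_pat ?rs 1 (final_pat C)" and ?w = "b - 2"
  have cases: "2 \<le> r \<and> r \<le> b \<and> (\<forall>j<d. j \<noteq> j1 \<longrightarrow> digit (prod_list us' * 1) r j \<le> (if j \<in> set vs then Suc ?w else 1))"
    if "?rs = us @ r # us'" for us r us'
  proof -
    from replicate_append_eq[OF that] consider
      (1) t where "r = b" "us' = replicate t b @ replicate n 2" | (2) us'' where "replicate n 2 = us'' @ r # us'"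
      by auto
    then show ?thesis
    proof cases
      case 1
      have "digit (prod_list us' * 1) r j \<le> (if j \<in> set vs then Suc ?w else 1)" if "j < d" "j \<noteq> j1" for j
      proof (cases "j \<in> set vs")
        case True
        then show ?thesis using digit_less[of r "prod_list us' * 1" j] b 1 by simp
      next
        case False
        \<comment> \<open>An unlisted variable has digit 0 here: its exponent is below the place
          value of every level in radix \<open>b\<close>.\<close>
        have "\<alpha> j < 2 ^ n" by (rule a3[OF that False])
        also have "(2::nat) ^ n \<le> b ^ t * 2 ^ n" using b by simp
        finally show ?thesis by (simp add: digit_def 1)
      qed
      with b 1 show ?thesis by auto
    next
      case 2
      then have "r = 2" using replicate_append_eq[of n 2 "[]" us'' r us'] by auto
      have "digit (prod_list us' * 1) r j \<le> (if j \<in> set vs then Suc ?w else 1)" for j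
        using digit_less[of r "prod_list us' * 1" j] \<open>r = 2\<close> by auto
      with b \<open>r = 2\<close> show ?thesis by simp
    qed
  qed
  have prod: "prod_list ?rs = b ^ k * 2 ^ n" by simp
  show "computes C (table_core C E k b vs n) (loads (-1) b ?w vs)"
    unfolding computes_def
  proof (intro allI impI, elim conjE)
    fix x f :: "nat \<Rightarrow> real" assume f: "\<forall>j<d. f (Suc j) = x j" "\<forall>i<q. f (slot i) = 0"
    define e where "e = f(0 := x j1)"
    note start = run_start[OF f, of "first_pat (replicate E q) (b ^ k * 2 ^ n) ?P", folded e_def]
    have e: "holds x e" "\<And>i. i < q \<Longrightarrow> e (slot i) = 0"
      using start by auto
    define e' where "e' = (\<lambda>i. e i + table x b ?w vs i)"
    have low: "table x b ?w vs i = 0" if "i < d + 2" for i using that by (simp add: table_def on_slots_def)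
    have h: "holds x e'" using e(1) low by (auto simp: e'_def holds_def)
    have e'0: "e' (slot i) = 0" if "i < b" for i
      using that e(2)[of i] b by (simp add: e'_def table_def)
    have tab: "e' (slot (b + t * ?w + s)) = x (vs ! t)" if "t < length vs" "s < ?w" for t s
    proof -
      have "t * ?w + s < Suc t * ?w" using that by simp
      also have "\<dots> \<le> length vs * ?w" using that by (intro mult_right_mono) auto
      finally have "b + t * ?w + s < q" using b by simp
      then show ?thesis using e(2)[of "b + t * ?w + s"] that by (simp add: e'_def table_def)
    qed
    have vsP: "\<forall>j\<in>set vs. j < d \<and> put e ?P A (Suc j) = x j" for A
    proof -
      have "fst ?P (Suc j) = 0 \<and> snd ?P (Suc j) = 0" if "j < d" for j
        using that by (cases ?rs) (auto simp: pat_def final_pat_def)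
      then show ?thesis using vs e(1) by (auto simp: put_def holds_def)
    qed
    \<comment> \<open>The tables are loaded while the next pattern is in place, which does not reach
      the variable entries that the loads read.\<close>
    have ld: "run (loads 1 b ?w vs) (put e ?P A) = put e' ?P A" for A
      by (subst run_loads[OF vsP], rule ext) (simp add: put_def e'_def low[of 0] algebra_simps)
    have "run (horner (copies b ?w vs) ?rs 1 (final_pat C)) (put e' ?P (monomial x (prod_list ?rs * 1)))
      = put e' (final_pat C) (monomial x 1)"
    proof (rule run_horner[OF h])
      fix us r us' assume "?rs = us @ r # us'"
      note c = cases[OF this]
      have "supplies (copies b ?w vs) e' x r (digit (prod_list us' * 1) r)"
        by (rule supplies_copies[OF h]) (use c tab in auto)
      with c e'0 show "r > 0 \<and> supplies (copies b ?w vs) e' x r (digit (prod_list us' * 1) r) \<and> (\<forall>i<r. e' (slot i) = 0)"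
        by auto
    qed
    then have main: "run (table_core C E k b vs n) f = put e' (final_pat C) (monomial x 1)"
      using start(1) run_head[OF e a2, of E ?P] monomial_1[OF a1, of x] ld[of "monomial x (b ^ k * 2 ^ n)"]
      by (simp add: table_core_def Let_def)
    have "run (loads (-1) b ?w vs) (put e' (final_pat C) (monomial x 1)) = put e (final_pat C) (monomial x 1)"
      by (subst run_loads[where x = x]) (use vs h low[of 0] in \<open>auto simp: put_def e'_def holds_def final_pat_def\<close>)
    moreover have "e' (Suc d) = f (Suc d)" by (simp add: e'_def low e_def)
    ultimately show "run (table_core C E k b vs n) f (Suc d) = f (Suc d) + C * monomial x 1 \<and>
      run (table_core C E k b vs n @ loads (-1) b ?w vs) f = f(0 := x j1, Suc d := f (Suc d) + C * monomial x 1)"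
      by (simp add: main put_final) (simp add: e_def)
  qed
  show "length (table_core C E k b vs n) = 1 + E + Suc (length vs) div 2 + k + n"
    "length (loads (-1) b ?w vs) = Suc (length vs) div 2"
    by (simp_all add: table_core_def Let_def loads_def length_pairs)
  have vd: "vs ! t < d" if "t < length vs" for t using vs nth_mem[OF that] by blast
  have lw: "\<forall>l\<in>set (loads c b ?w vs). layer_within (d + 2 + q) l" for c
    unfolding loads_def by (rule pairs_within) (auto simp: load_upd_def intro!: less_SucI trans_less_add1 vd)
  have "\<forall>l\<in>set (horner (copies b ?w vs) ?rs 1 (final_pat C)). layer_within (d + 2 + q) l"
  proof (rule horner_within[OF refl])
    show "r \<le> q" if "r \<in> set ?rs" for r using that b q by auto
    fix us r us' j s
    assume "?rs = us @ r # us'" and js: "j < d" "j \<noteq> j1" "s < digit (prod_list us' * 1) r j"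
    from cases[OF this(1)] js show "copies b ?w vs j s \<in> {1..<d + 2 + q}"
      by (intro copies_within[OF refl js(1,3) _ b(2)]) auto
  qed
  then show "\<forall>l\<in>set (table_core C E k b vs n @ loads (-1) b ?w vs). layer_within (d + 2 + q) l"
    using horner_replicate_within[OF refl _ _ a2, of q E] q init_layer_within lw
    unfolding table_core_def Let_def list_all_iff[symmetric] by simp
qed

end

section \<open>Choice of the radices\<close>

lemma square_le_power2: "e * e \<le> 2 ^ (e + 1)" for e :: nat
proof (induction e)
  case (Suc e)
  have "e < 2 ^ e" by (rule less_exp)
  then have "2 * e + 1 \<le> 2 * 2 ^ e" by linarith
  then have "2 * e + 1 \<le> 2 ^ (e + 1)" by simp
  with Suc show ?case by simp
qed simp

text \<open>It is applied with \<open>a + 1\<close> the rounded-up square root and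
  \<open>e + 2\<close> the rounded-up binary logarithm of \<open>q\<close>; the left-hand side
  counts working slots and tables for \<open>t\<close> variables. If \<open>e \<le> a\<close>, then
  \<open>a * a < q\<close> bounds it, otherwise \<open>e * e \<le> 2 ^ (e + 1)\<close> does.\<close>

lemma slots_suffice:
  fixes a e q t :: nat
  assumes "a * a < q" "2 ^ (e + 1) < q" "t \<le> e" "a > 0"
  shows "a + 1 + t * (a - 1) \<le> q"
proof (cases "e \<le> a")
  case True
  with assms(3) have "t * (a - 1) \<le> a * (a - 1)" by (intro mult_right_mono) auto
  moreover have "a + a * (a - 1) = a * a" using assms(4) by (cases a) auto
  ultimately show ?thesis using assms(1) by linarith
next
  case False
  have "t * (a - 1) \<le> e * (e - 1)" using assms(3) False by (intro mult_mono) auto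
  moreover have "e + e * (e - 1) = e * e" by (cases e) auto
  ultimately show ?thesis using assms(2) square_le_power2[of e] False by linarith
qed

text \<open>Double counting of the pairs of a variable and one of its digit positions.\<close>

lemma sum_count_levels:
  fixes D :: "nat \<Rightarrow> nat"
  assumes "\<And>j. j < d \<Longrightarrow> D j \<le> K"
  shows "(\<Sum>j<d. D j) = (\<Sum>k<K. card {j. j < d \<and> k < D j})"
proof -
  have "(\<Sum>j<d. D j) = (\<Sum>j<d. \<Sum>k<K. of_bool (k < D j))"
  proof (intro sum.cong refl)
    fix j assume "j \<in> {..<d}"
    then have "{k. k < K \<and> k < D j} = {..<D j}" using assms[of j] by auto
    then show "D j = (\<Sum>k<K. of_bool (k < D j))"
      by (simp add: of_bool_def sum.If_cases Int_def)
  qed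
  also have "\<dots> = (\<Sum>k<K. \<Sum>j<d. of_bool (k < D j))" by (rule sum.swap)
  also have "\<dots> = (\<Sum>k<K. card {j. j < d \<and> k < D j})"
    by (simp add: of_bool_def sum.If_cases Int_def)
  finally show ?thesis .
qed

lemma ex_log_ceiling:
  fixes q :: nat
  assumes "q \<ge> 2"
  obtains c where "c \<ge> 1" "q \<le> 2 ^ c" "2 ^ (c - 1) < q"
proof -
  define c where "c = (LEAST c. q \<le> 2 ^ c)"
  have ex: "q \<le> 2 ^ q" by (simp add: less_imp_le)
  have le: "q \<le> 2 ^ c" unfolding c_def by (rule LeastI[of _ q]) (rule ex)
  then have "c \<noteq> 0" using assms by (intro notI) simp
  moreover have "\<not> q \<le> 2 ^ (c - 1)"
    using not_less_Least[of "c - 1" "\<lambda>c. q \<le> 2 ^ c"] \<open>c \<noteq> 0\<close> by (simp add: c_def)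
  ultimately show ?thesis using le that[of c] by simp
qed

lemma ex_sqrt_ceiling:
  fixes q :: nat
  assumes "q \<ge> 1"
  obtains b where "b \<ge> 1" "q \<le> b * b" "(b - 1) * (b - 1) < q"
proof -
  define b where "b = (LEAST b. q \<le> b * b)"
  have le: "q \<le> b * b" unfolding b_def by (rule LeastI[of _ q]) simp
  then have "b \<noteq> 0" using assms by (intro notI) simp
  moreover have "\<not> q \<le> (b - 1) * (b - 1)"
    using not_less_Least[of "b - 1" "\<lambda>b. q \<le> b * b"] \<open>b \<noteq> 0\<close> by (simp add: b_def)
  ultimately show ?thesis using le that[of b] by simp
qed

text \<open>The maximum with 1 reserves room for the output layer, which takes the place of the last
  cleanup. The second length bound has no factor \<open>d\<close>, as the count of non-zero
  parameters requires.\<close>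

lemma monomial_program:
  fixes d q c :: nat and D \<alpha> :: "nat \<Rightarrow> nat" and C :: real
  assumes d: "d \<ge> 1" and q: "q \<ge> 2" and c: "c \<ge> 1" "q \<le> 2 ^ c" "2 ^ (c - 1) < q"
    and D: "\<And>j. j < d \<Longrightarrow> D j \<ge> 1" "\<And>j. j < d \<Longrightarrow> \<alpha> j < q ^ D j" "\<And>j. j < d \<Longrightarrow> D j \<le> K'"
  obtains j1 core cleanup where "j1 < d" "workspace.computes d q j1 \<alpha> C core cleanup"
    "\<forall>l\<in>set (core @ cleanup). layer_within (d + 2 + q) l"
    "length core + max 1 (length cleanup) \<le> 2 + (\<Sum>j<d. D j)"
    "length core + length cleanup \<le> (3 + 2 * c) * K'"
proof -
  define K where "K = Max (D ` {..<d})"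
  have fin: "finite (D ` {..<d})" "D ` {..<d} \<noteq> {}" using d by (auto simp: lessThan_empty_iff)
  obtain j1 where arg: "j1 < d" "D j1 = K"
    using Max_in[OF fin] unfolding K_def by (metis imageE lessThan_iff)
  have DK: "D j \<le> K" if "j < d" for j unfolding K_def using that fin by (intro Max_ge) auto
  have K: "1 \<le> K" "K \<le> K'" using arg D by auto
  interpret workspace d q j1 \<alpha> by unfold_locales (use arg q in auto)
  define S where "S k = {j. j < d \<and> k < D j}" for k
  define N where "N k = card (S k)" for k
  have finS: "finite (S k)" for k by (simp add: S_def)
  have anti: "N k' \<le> N k" if "k \<le> k'" for k k'
    unfolding N_def using that by (intro card_mono finS) (auto simp: S_def)
  have N_pos: "N k \<ge> 1" if "k < K" for k
  proof -
    have "j1 \<in> S k" using arg that by (simp add: S_def)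
    then show ?thesis unfolding N_def using finS[of k] by (metis One_nat_def Suc_leI card_gt_0_iff empty_iff)
  qed
  have "S K = {}" using DK by (force simp: S_def)
  then have NK: "N K = 0" by (simp add: N_def)
  have total: "(\<Sum>j<d. D j) = (\<Sum>k<K. N k)"
    using sum_count_levels[of d D K] DK by (simp add: N_def S_def)
  have card_rest: "card (S k - {j1}) = N k - 1" if "k < K" for k
    using that arg by (simp add: N_def S_def)
  \<comment> \<open>Each level below \<open>l\<close> has at least \<open>c\<close> active
    variables, and \<open>c\<close> binary digits cover one base-\<open>q\<close> digit.\<close>
  define l where "l = (LEAST k. N k < c)"
  have "N K < c" using NK c by simp
  then have l: "N l < c" "l \<le> K" unfolding l_def by (rule LeastI, rule Least_le)
  have low: "c \<le> N k" if "k < l" for k using not_less_Least[OF that[unfolded l_def]] by simp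
  define m' where "m' = (LEAST k. N k < 2)"
  have "N K < 2" using NK by simp
  then have m': "N m' < 2" "m' \<le> K" unfolding m'_def by (rule LeastI, rule Least_le)
  have mid': "2 \<le> N k" if "k < m'" for k using not_less_Least[OF that[unfolded m'_def]] by simp
  \<comment> \<open>The middle levels are those from \<open>l\<close> to below \<open>m\<close>;
    from \<open>m\<close> on only \<open>x j1\<close> is active.\<close>
  define m where "m = max l m'"
  have m: "l \<le> m" "m \<le> K" "N m < 2" using l m' anti[of m' m] by (auto simp: m_def)
  have mid: "2 \<le> N k" if "l \<le> k" "k < m" for k using that mid'[of k] by (auto simp: m_def)
  have top: "N k = 1" if "m \<le> k" "k < K" for k using N_pos[OF that(2)] anti[OF that(1)] m(3) by simp
  define n where "n = c * l"
  define E where "E = K - m"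
  have split: "(\<Sum>k<K. N k) = (\<Sum>k<l. N k) + (\<Sum>k=l..<m. N k) + (\<Sum>k=m..<K. N k)"
    using m(1,2) by (simp add: sum.atLeastLessThan_concat lessThan_atLeast0)
  have "(\<Sum>k=m..<K. N k) = E" using top by (simp add: E_def)
  moreover have "n \<le> (\<Sum>k<l. N k)"
    using sum_mono[of "{..<l}" "\<lambda>_. c" N] low by (simp add: n_def mult.commute)
  ultimately have budget: "n + (\<Sum>k=l..<m. N k) + E \<le> (\<Sum>j<d. D j)" using total split by simp
  have nK: "n \<le> c * K" using l by (simp add: n_def)
  have ql: "q ^ l \<le> 2 ^ n"
    unfolding n_def power_mult using c(2) by (intro power_mono) auto
  have \<alpha>D: "\<alpha> j < q ^ k" if "j < d" "D j \<le> k" for j k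
    using D(2)[OF that(1)] power_increasing[OF that(2), of q] q by linarith
  have other: "D j \<le> m" if "j < d" "j \<noteq> j1" for j
  proof (rule ccontr)
    assume "\<not> D j \<le> m"
    then have "{j, j1} \<subseteq> S m" using that arg DK[OF that(1)] by (auto simp: S_def)
    from card_mono[OF finS this] have "2 \<le> N m" using that(2) by (simp add: N_def)
    with m(3) show False by simp
  qed
  have KK: "(3 + 2 * c) * K \<le> (3 + 2 * c) * K'" using K by (intro mult_left_mono) auto
  show ?thesis
  proof (cases "l < m")
    case False
    then have lm: "m = l" using m by simp
    have "q ^ K = q ^ E * q ^ l" using m by (simp add: E_def lm flip: power_add)
    also have "\<dots> \<le> q ^ E * 2 ^ n" using ql by simp
    finally have le: "q ^ K \<le> q ^ E * 2 ^ n" .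
    have a1: "\<alpha> j < q ^ E * 2 ^ n" if "j < d" for j using \<alpha>D[OF that DK[OF that]] le by linarith
    have a2: "\<alpha> j < 2 ^ n" if "j < d" "j \<noteq> j1" for j using \<alpha>D[OF that(1) other[OF that]] ql lm by simp
    note core = simple_core[OF a1 a2]
    have len: "1 + E + n \<le> (3 + 2 * c) * K"
      using K(1) nK m by (simp add: E_def algebra_simps)
    show ?thesis
      by (rule that[OF arg(1) core(1)]) (use core(2)[of C] core(3)[of C] budget le_trans[OF len KK] in auto)
  next
    case True
    define k where "k = m - l"
    define T where "T = N l"
    have k: "k > 0" "m = l + k" using True by (auto simp: k_def)
    have T: "2 \<le> T" "T < c" using mid[of l] True l by (auto simp: T_def)
    have "3 \<le> c" using T by simp
    then have "(2::nat) ^ 2 \<le> 2 ^ (c - 1)" by (intro power_increasing) auto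
    then have q5: "q \<ge> 5" using c(3) by simp
    have lK: "l < K" using True m by simp
    have mid_sum: "(\<Sum>i=l..<m. N i) = T + (\<Sum>i=Suc l..<m. N i)"
      using True by (simp add: sum.atLeast_Suc_lessThan T_def)
    have "(\<Sum>i=Suc l..<m. 2) \<le> (\<Sum>i=Suc l..<m. N i)" using mid by (intro sum_mono) auto
    then have mid_ge: "2 * (k - 1) \<le> (\<Sum>i=Suc l..<m. N i)" by (simp add: k_def)
    have qK: "q ^ K = q ^ E * q ^ m" using m by (simp add: E_def flip: power_add)
    \<comment> \<open>Tables cost \<open>T div 2\<close> layers for loading, as many for erasing,
      and two per middle level. The budget allows this unless \<open>T\<close> is even and all later
      middle levels have exactly two variables.\<close>
    show ?thesis
    proof (cases "even T \<and> (\<forall>i. l < i \<and> i < m \<longrightarrow> N i = 2)")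
      case True
      have qm: "q ^ m \<le> q ^ k * 2 ^ n" using ql by (simp add: k(2) power_add)
      then have "q ^ E * q ^ m \<le> q ^ E * (q ^ k * 2 ^ n)" by (intro mult_left_mono) auto
      then have le: "q ^ K \<le> q ^ E * (q ^ k * 2 ^ n)" by (simp only: qK)
      have a1: "\<alpha> j < q ^ E * (q ^ k * 2 ^ n)" if "j < d" for j using \<alpha>D[OF that DK[OF that]] le by linarith
      have a2: "\<alpha> j < q ^ k * 2 ^ n" if "j < d" "j \<noteq> j1" for j using \<alpha>D[OF that(1) other[OF that]] qm by linarith
      have reps_le: "length (reps (digit (q ^ t * 2 ^ n) q)) \<le> max 1 (N (l + t) - 1)" if "l + t < K" for t
      proof -
        have "j \<in> S (l + t) - {j1}" if j: "j < d" "j \<noteq> j1" and nz: "digit (q ^ t * 2 ^ n) q j \<noteq> 0" for j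
        proof (rule ccontr)
          assume "j \<notin> S (l + t) - {j1}"
          then have "\<alpha> j < q ^ (l + t)" using j by (intro \<alpha>D) (auto simp: S_def)
          also have "\<dots> \<le> q ^ t * 2 ^ n" using ql by (simp add: power_add mult.commute)
          finally show False using nz by (simp add: digit_def)
        qed
        from length_reps[OF _ this] card_rest[OF \<open>l + t < K\<close>] finS show ?thesis by simp
      qed
      have one: "length (reps (digit (q ^ t * 2 ^ n) q)) \<le> 1" if "1 \<le> t" "t < k" for t
        using reps_le[of t] True that k m by simp
      have reps0: "length (reps (digit (2 ^ n) q)) \<le> T - 1"
        using reps_le[of 0] lK T by (simp add: T_def)
      have "3 \<le> q" using q5 by simp
      note core = even_core[OF this k(1) a1 a2 one]
      obtain u where u: "T = 2 * u" using True by auto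
      have cl: "length (even_cleanup n) \<le> u" using core(3) reps0 u q5 by linarith
      have co: "length (even_core C E k n) \<le> 1 + E + (2 * k + (u - 1)) + n"
        using core(2)[where C = C] reps0 u T q5 by linarith
      \<comment> \<open>The bounds on core and cleanup add up to
        \<open>E + n + 2 * u + 2 * k\<close>. The budget provides this much: the middle levels give
        at least \<open>T + 2 * (k - 1)\<close>, and two further layers are available.\<close>
      have b1: "length (even_core C E k n) + max 1 (length (even_cleanup n)) \<le> 2 + (\<Sum>j<d. D j)"
        using cl co u T mid_sum mid_ge budget k(1) by linarith
      have "1 + E + (2 * k + (u - 1)) + n + u \<le> (3 + 2 * c) * K"
      proof -
        have "2 * u \<le> c * K" using u T K(1) by (metis less_imp_le_nat mult_le_mono mult.right_neutral)
        moreover have "E + k \<le> K" "k \<le> K" using m k by (auto simp: E_def)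
        ultimately show ?thesis using nK K(1) by (simp add: algebra_simps)
      qed
      then have b2: "length (even_core C E k n) + length (even_cleanup n) \<le> (3 + 2 * c) * K'"
        using cl co KK by linarith
      show ?thesis
        by (rule that[OF arg(1) core(1) core(4) b1 b2])
    next
      case False
      obtain b where b: "b \<ge> 1" "q \<le> b * b" "(b - 1) * (b - 1) < q"
        using ex_sqrt_ceiling[of q] q by auto
      have b3: "b \<ge> 3"
      proof (rule ccontr)
        assume "\<not> b \<ge> 3"
        then have "b * b \<le> 2 * 2" by (intro mult_le_mono) auto
        with b(2) q5 show False by simp
      qed
      define vs where "vs = sorted_list_of_set (S l - {j1})"
      have vs: "set vs = S l - {j1}" "length vs = T - 1"
        using finS[of l] card_rest[OF lK] by (auto simp: vs_def T_def)
      have "b - 1 + 1 + (T - 1) * (b - 1 - 1) \<le> q"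
      proof (rule slots_suffice)
        show "(b - 1) * (b - 1) < q" by (rule b(3))
        have "c - 2 + 1 = c - 1" using \<open>3 \<le> c\<close> by simp
        then show "2 ^ (c - 2 + 1) < q" using c(3) by simp
        show "T - 1 \<le> c - 2" using T by simp
        show "b - 1 > 0" using b3 by simp
      qed
      then have slots: "b + length vs * (b - 2) \<le> q" using b3 vs by (simp add: numeral_2_eq_2)
      \<comment> \<open>Two digits in radix \<open>b\<close> replace one digit in base
        \<open>q\<close>.\<close>
      have "q ^ k \<le> b ^ (2 * k)"
        using power_mono[OF b(2), of k] by (simp add: power_mult power2_eq_square)
      then have qm: "q ^ m \<le> b ^ (2 * k) * 2 ^ n"
        using ql by (simp add: k(2) power_add) (metis mult.commute mult_le_mono)
      then have "q ^ E * q ^ m \<le> q ^ E * (b ^ (2 * k) * 2 ^ n)" by (intro mult_left_mono) auto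
      then have le: "q ^ K \<le> q ^ E * (b ^ (2 * k) * 2 ^ n)" by (simp only: qK)
      have a1: "\<alpha> j < q ^ E * (b ^ (2 * k) * 2 ^ n)" if "j < d" for j using \<alpha>D[OF that DK[OF that]] le by linarith
      have a2: "\<alpha> j < b ^ (2 * k) * 2 ^ n" if "j < d" "j \<noteq> j1" for j using \<alpha>D[OF that(1) other[OF that]] qm by linarith
      have a3: "\<alpha> j < 2 ^ n" if "j < d" "j \<noteq> j1" "j \<notin> set vs" for j
      proof -
        have "D j \<le> l" using that vs by (auto simp: S_def)
        from \<alpha>D[OF that(1) this] ql show ?thesis by linarith
      qed
      have vd: "\<forall>j\<in>set vs. j < d" using vs by (auto simp: S_def)
      note core = table_core[OF b3 slots vd a1 a2 a3]
      have lenvs: "Suc (length vs) = T" using vs T by simp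
      \<comment> \<open>One layer has to be saved: for even \<open>T\<close> by a level with more
        than two variables, for odd \<open>T\<close> by rounding.\<close>
      have strict: "2 * (T div 2) + 2 * k \<le> 1 + (\<Sum>i=l..<m. N i)"
      proof (cases "even T")
        case True
        with False obtain i where i: "l < i" "i < m" "N i \<noteq> 2" by auto
        have "(\<Sum>i=Suc l..<m. 2) < (\<Sum>i=Suc l..<m. N i)"
        proof (rule sum_strict_mono_ex1)
          show "\<forall>x\<in>{Suc l..<m}. 2 \<le> N x" using mid by auto
          show "\<exists>a\<in>{Suc l..<m}. 2 < N a" using i mid[of i] by (intro bexI[of _ i]) auto
        qed simp
        then have "2 * (k - 1) < (\<Sum>i=Suc l..<m. N i)" by (simp add: k_def)
        moreover have "2 * (T div 2) = T" using True by simp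
        ultimately show ?thesis using mid_sum k(1) by linarith
      next
        case False
        then have "2 * (T div 2) = T - 1" by presburger
        with mid_sum mid_ge k T show ?thesis by linarith
      qed
      have b1: "length (table_core C E (2 * k) b vs n) + max 1 (length (loads (-1) b (b - 2) vs)) \<le> 2 + (\<Sum>j<d. D j)"
      proof -
        have "1 \<le> T div 2" using T by linarith
        with core(2)[where C = C] core(3) strict budget show ?thesis unfolding lenvs by linarith
      qed
      have "1 + E + T div 2 + 2 * k + n + T div 2 \<le> (3 + 2 * c) * K"
      proof -
        have "T \<le> c * K" using T K(1) by (metis less_imp_le_nat mult_le_mono mult.right_neutral)
        moreover have "2 * (T div 2) \<le> T" by simp
        moreover have "E + k \<le> K" "k \<le> K" using m k by (auto simp: E_def)
        ultimately show ?thesis using nK K(1) by (simp add: algebra_simps)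
      qed
      then have b2: "length (table_core C E (2 * k) b vs n) + length (loads (-1) b (b - 2) vs) \<le> (3 + 2 * c) * K'"
        using core(2)[where C = C] core(3) KK unfolding lenvs by linarith
      show ?thesis
        by (rule that[OF arg(1) core(1) core(4) b1 b2])
    qed
  qed
qed

section \<open>The polynomial\<close>

lemma floor_log_mono:
  assumes "q \<ge> 2" "1 \<le> m" "m \<le> n"
  shows "floor_log q m \<le> floor_log q n"
  unfolding floor_log_def using assms by (intro nat_mono floor_mono) simp

lemma less_power_floor_log:
  assumes "q \<ge> 2" "n \<ge> 1"
  shows "n < q ^ (floor_log q n + 1)"
proof -
  have "log q n \<ge> 0" using assms by simp
  then have "log q n < real (floor_log q n + 1)" unfolding floor_log_def by linarith
  then have "real n < real q powr real (floor_log q n + 1)" using assms by (subst (asm) log_less_iff) auto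
  also have "\<dots> = real (q ^ (floor_log q n + 1))" using assms by (subst powr_realpow) auto
  finally show ?thesis by linarith
qed

lemma exponent_le_max_exponent:
  assumes "finite \<Lambda>" "\<alpha> \<in> \<Lambda>" "j < d"
  shows "\<alpha> $ j \<le> max_exponent d \<Lambda>"
proof -
  have "\<alpha> $ j \<le> max_exponent_in \<Lambda> j"
    unfolding max_exponent_in_def using assms by (intro Max_ge) auto
  also have "\<dots> \<le> max_exponent d \<Lambda>"
    unfolding max_exponent_def using assms by (intro Max_ge) auto
  finally show ?thesis .
qed

text \<open>The affine coefficient at entry 0 cancels its old content, and the accumulator moves to
  where the retraction reads.\<close>

definition output_layer :: "nat \<Rightarrow> layer" where
  "output_layer d = (({Suc d}, (\<lambda>j. of_bool (j = 0)), (\<lambda>_. 0)), ({}, (\<lambda>_. 0), (\<lambda>j. - of_bool (j = 0))))"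

lemma run_output_layer: "run_layer (output_layer d) f 0 = f (Suc d)"
  by (simp add: output_layer_def run_layer_def)

lemma polynomial_program:
  fixes C :: "nat vec \<Rightarrow> real"
  assumes d: "d \<ge> 1" and q: "q \<ge> 2" and c: "c \<ge> 1" "q \<le> 2 ^ c" "2 ^ (c - 1) < q"
    and \<Lambda>: "finite \<Lambda>" "\<Lambda> \<noteq> {}"
  obtains prog where "\<forall>l\<in>set prog. layer_within (d + 2 + q) l"
    "length prog \<le> num_layers q d \<Lambda>"
    "length prog \<le> card \<Lambda> * ((4 + 2 * c) * (floor_log q (max_exponent d \<Lambda> + 1) + 1))"
    "\<And>x. run prog (\<lambda>i. if 1 \<le> i \<and> i \<le> d then x (i - 1) else 0) 0 = (\<Sum>\<alpha>\<in>\<Lambda>. C \<alpha> * (\<Prod>j<d. x j ^ (\<alpha> $ j)))"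
proof -
  define M where "M = floor_log q (max_exponent d \<Lambda> + 1)"
  \<comment> \<open>An upper bound for the number of base-\<open>q\<close> digits; 2 plus the sum
    over \<open>j\<close> is the share of \<alpha> in \<open>num_layers\<close>.\<close>
  define D where "D \<alpha> j = floor_log q (\<alpha> $ j + 1) + 1" for \<alpha> j
  define summand where "summand x \<alpha> = C \<alpha> * (\<Prod>j<d. x j ^ (\<alpha> $ j))" for x :: "nat \<Rightarrow> real" and \<alpha>
  define good where "good \<alpha> P \<longleftrightarrow> (\<forall>l\<in>set (fst P @ snd P). layer_within (d + 2 + q) l) \<and>
      length (fst P) + max 1 (length (snd P)) \<le> 2 + (\<Sum>j<d. D \<alpha> j) \<and>
      length (fst P) + length (snd P) \<le> (3 + 2 * c) * (M + 1) \<and>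
      (\<forall>x f. (\<forall>j<d. f (Suc j) = x j) \<and> (\<forall>i<q. f (d + 2 + i) = 0) \<longrightarrow>
        run (fst P) f (Suc d) = f (Suc d) + summand x \<alpha> \<and>
        (\<exists>y. run (fst P @ snd P) f = f(0 := y, Suc d := f (Suc d) + summand x \<alpha>)))"
    for \<alpha> :: "nat vec" and P :: "layer list \<times> layer list"
  have "\<exists>P. good \<alpha> P" if "\<alpha> \<in> \<Lambda>" for \<alpha>
  proof -
    have D1: "1 \<le> D \<alpha> j" if "j < d" for j by (simp add: D_def)
    have D2: "\<alpha> $ j < q ^ D \<alpha> j" if "j < d" for j
      using less_power_floor_log[OF q, of "\<alpha> $ j + 1"] by (simp add: D_def)
    have D3: "D \<alpha> j \<le> M + 1" if "j < d" for j
      using floor_log_mono[OF q, of "\<alpha> $ j + 1"] exponent_le_max_exponent[OF \<Lambda>(1) \<open>\<alpha> \<in> \<Lambda>\<close> that]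
      by (simp add: D_def M_def)
    obtain j1 core cleanup where P: "j1 < d" "workspace.computes d q j1 (($) \<alpha>) (C \<alpha>) core cleanup"
      "\<forall>l\<in>set (core @ cleanup). layer_within (d + 2 + q) l"
      "length core + max 1 (length cleanup) \<le> 2 + (\<Sum>j<d. D \<alpha> j)"
      "length core + length cleanup \<le> (3 + 2 * c) * (M + 1)"
      by (rule monomial_program[OF d q c D1 D2 D3])
    interpret workspace d q j1 "($) \<alpha>" by unfold_locales (use P(1) q in auto)
    have "C \<alpha> * monomial x 1 = summand x \<alpha>" for x by (simp add: monomial_def summand_def)
    with P have "good \<alpha> (core, cleanup)" unfolding good_def computes_def slot_def by auto
    then show ?thesis by blast
  qed
  then obtain P where P: "\<And>\<alpha>. \<alpha> \<in> \<Lambda> \<Longrightarrow> good \<alpha> (P \<alpha>)" by metis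
  \<comment> \<open>Between monomials the variables are intact and the slots are empty, while entry
    0 is left unconstrained.\<close>
  have run_list: "\<exists>g. run (concat (map (\<lambda>\<alpha>. fst (P \<alpha>) @ snd (P \<alpha>)) \<alpha>s)) f = g \<and> (\<forall>j<d. g (Suc j) = x j) \<and>
      (\<forall>i<q. g (d + 2 + i) = 0) \<and> g (Suc d) = f (Suc d) + (\<Sum>\<alpha>\<leftarrow>\<alpha>s. summand x \<alpha>)"
    if "set \<alpha>s \<subseteq> \<Lambda>" "\<forall>j<d. f (Suc j) = x j" "\<forall>i<q. f (d + 2 + i) = 0" for \<alpha>s f x
    using that
  proof (induction \<alpha>s arbitrary: f)
    case (Cons \<alpha> \<alpha>s)
    then have "good \<alpha> (P \<alpha>)" using P by simp
    with Cons.prems obtain y where y: "run (fst (P \<alpha>) @ snd (P \<alpha>)) f = f(0 := y, Suc d := f (Suc d) + summand x \<alpha>)"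
      unfolding good_def by blast
    let ?f = "f(0 := y, Suc d := f (Suc d) + summand x \<alpha>)"
    have "\<exists>g. run (concat (map (\<lambda>\<alpha>. fst (P \<alpha>) @ snd (P \<alpha>)) \<alpha>s)) ?f = g \<and> (\<forall>j<d. g (Suc j) = x j) \<and>
      (\<forall>i<q. g (d + 2 + i) = 0) \<and> g (Suc d) = ?f (Suc d) + (\<Sum>\<alpha>\<leftarrow>\<alpha>s. summand x \<alpha>)"
      by (rule Cons.IH) (use Cons.prems in auto)
    moreover have "run (concat (map (\<lambda>\<alpha>. fst (P \<alpha>) @ snd (P \<alpha>)) (\<alpha> # \<alpha>s))) f
      = run (concat (map (\<lambda>\<alpha>. fst (P \<alpha>) @ snd (P \<alpha>)) \<alpha>s)) ?f"
      using y by (simp only: list.map concat.simps run_append)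
    ultimately show ?case by simp
  qed simp
  obtain \<beta> where \<beta>: "\<beta> \<in> \<Lambda>" using \<Lambda>(2) by blast
  obtain \<alpha>s where \<alpha>s: "set \<alpha>s = \<Lambda> - {\<beta>}" "distinct \<alpha>s"
    using finite_distinct_list[of "\<Lambda> - {\<beta>}"] \<Lambda>(1) by auto
  \<comment> \<open>The last monomial needs no cleanup, which leaves room for the output layer.\<close>
  define prog where "prog = concat (map (\<lambda>\<alpha>. fst (P \<alpha>) @ snd (P \<alpha>)) \<alpha>s) @ fst (P \<beta>) @ [output_layer d]"
  have g\<beta>: "good \<beta> (P \<beta>)" by (rule P[OF \<beta>])
  have sum_split: "(\<Sum>\<alpha>\<in>\<Lambda>. g \<alpha>) = (\<Sum>\<alpha>\<leftarrow>\<alpha>s. g \<alpha>) + g \<beta>" for g :: "nat vec \<Rightarrow> 'a :: comm_monoid_add"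
    using \<alpha>s \<beta> \<Lambda>(1) by (simp add: sum_list_distinct_conv_sum_set sum.remove[of \<Lambda> \<beta>] add.commute)
  have len: "length prog = (\<Sum>\<alpha>\<leftarrow>\<alpha>s. length (fst (P \<alpha>)) + length (snd (P \<alpha>))) + (length (fst (P \<beta>)) + 1)"
    by (simp add: prog_def length_concat comp_def)
  show ?thesis
  proof (rule that)
    have "layer_within (d + 2 + q) (output_layer d)" using q by (simp add: output_layer_def layer_within_def)
    then show "\<forall>l\<in>set prog. layer_within (d + 2 + q) l"
      using P \<beta> \<alpha>s(1) unfolding prog_def good_def by fastforce
    have "length prog \<le> (\<Sum>\<alpha>\<leftarrow>\<alpha>s. 2 + (\<Sum>j<d. D \<alpha> j)) + (2 + (\<Sum>j<d. D \<beta> j))"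
      unfolding len
    proof (rule add_mono[OF sum_list_mono])
      fix \<alpha> assume "\<alpha> \<in> set \<alpha>s"
      then have "good \<alpha> (P \<alpha>)" using P \<alpha>s(1) by auto
      then show "length (fst (P \<alpha>)) + length (snd (P \<alpha>)) \<le> 2 + (\<Sum>j<d. D \<alpha> j)"
        unfolding good_def by linarith
    next
      show "length (fst (P \<beta>)) + 1 \<le> 2 + (\<Sum>j<d. D \<beta> j)" using g\<beta> unfolding good_def by linarith
    qed
    also have "\<dots> = (\<Sum>\<alpha>\<in>\<Lambda>. 2 + (\<Sum>j<d. D \<alpha> j))" by (rule sum_split[symmetric])
    also have "\<dots> = num_layers q d \<Lambda>"
      by (simp add: num_layers_def D_def sum.distrib algebra_simps sum_Suc)
    finally show "length prog \<le> num_layers q d \<Lambda>" .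
    have "length prog \<le> (\<Sum>\<alpha>\<leftarrow>\<alpha>s. (3 + 2 * c) * (M + 1)) + ((3 + 2 * c) * (M + 1) + 1)"
      unfolding len
    proof (rule add_mono[OF sum_list_mono])
      fix \<alpha> assume "\<alpha> \<in> set \<alpha>s"
      then have "good \<alpha> (P \<alpha>)" using P \<alpha>s(1) by auto
      then show "length (fst (P \<alpha>)) + length (snd (P \<alpha>)) \<le> (3 + 2 * c) * (M + 1)"
        unfolding good_def by linarith
    next
      show "length (fst (P \<beta>)) + 1 \<le> (3 + 2 * c) * (M + 1) + 1" using g\<beta> unfolding good_def by linarith
    qed
    also have "\<dots> = (\<Sum>\<alpha>\<in>\<Lambda>. (3 + 2 * c) * (M + 1)) + 1" by (simp only: sum_split add.assoc)
    also have "\<dots> = card \<Lambda> * ((3 + 2 * c) * (M + 1)) + 1" by simp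
    \<comment> \<open>The output layer is absorbed by
      \<open>card \<Lambda> * (M + 1) \<ge> 1\<close>, which raises the factor
      \<open>3 + 2 * c\<close> to \<open>4 + 2 * c\<close>.\<close>
    also have "\<dots> \<le> card \<Lambda> * ((3 + 2 * c) * (M + 1)) + card \<Lambda> * (M + 1)"
      using \<Lambda> by (simp add: Suc_le_eq card_gt_0_iff)
    also have "\<dots> = card \<Lambda> * ((4 + 2 * c) * (M + 1))" by (simp add: algebra_simps)
    finally show "length prog \<le> card \<Lambda> * ((4 + 2 * c) * (floor_log q (max_exponent d \<Lambda> + 1) + 1))"
      by (simp only: M_def)
    fix x :: "nat \<Rightarrow> real"
    let ?f = "\<lambda>i. if 1 \<le> i \<and> i \<le> d then x (i - 1) else 0"
    obtain g where g: "run (concat (map (\<lambda>\<alpha>. fst (P \<alpha>) @ snd (P \<alpha>)) \<alpha>s)) ?f = g" "\<forall>j<d. g (Suc j) = x j"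
      "\<forall>i<q. g (d + 2 + i) = 0" "g (Suc d) = (\<Sum>\<alpha>\<leftarrow>\<alpha>s. summand x \<alpha>)"
      using run_list[of \<alpha>s ?f x] \<alpha>s(1) by auto
    have "run prog ?f 0 = run (fst (P \<beta>)) g (Suc d)"
      by (simp add: prog_def g(1) run_output_layer del: One_nat_def)
    also have "\<dots> = g (Suc d) + summand x \<beta>"
      using g\<beta> g(2,3) unfolding good_def by blast
    also have "\<dots> = (\<Sum>\<alpha>\<leftarrow>\<alpha>s. summand x \<alpha>) + summand x \<beta>" by (simp only: g(4))
    also have "\<dots> = (\<Sum>\<alpha>\<in>\<Lambda>. summand x \<alpha>)" by (rule sum_split[symmetric])
    finally show "run prog ?f 0 = (\<Sum>\<alpha>\<in>\<Lambda>. C \<alpha> * (\<Prod>j<d. x j ^ (\<alpha> $ j)))"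
      by (simp only: summand_def)
  qed
qed

section \<open>Padding with zero layers and the final estimates\<close>

lemma sum_list_le_const:
  fixes f :: "'a \<Rightarrow> nat"
  assumes "\<And>x. x \<in> set xs \<Longrightarrow> f x \<le> b"
  shows "(\<Sum>x\<leftarrow>xs. f x) \<le> length xs * b"
  using assms by (induction xs) fastforce+

text \<open>Zero layers pad the program to length \<open>L\<close>. Non-zero parameters arise only
  in the program itself, whose length bound has no factor \<open>d\<close>; counting all
  \<open>L\<close> layers would cost another factor \<open>d\<close>.\<close>

lemma polynomial_encoding:
  fixes C :: "nat vec \<Rightarrow> real"
  assumes d: "d \<ge> 1" and q: "q \<ge> 2" and c: "c \<ge> 1" "q \<le> 2 ^ c" "2 ^ (c - 1) < q"
    and \<Lambda>: "finite \<Lambda>" "\<Lambda> \<noteq> {}" and p: "p = d + 2 + q" and L: "L = num_layers q d \<Lambda>"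
  obtains \<psi>s Us where "length \<psi>s = L" "length Us = L"
    "\<forall>l<L. tt_represents affine_basis p (layer_ranks p) (Us ! l) (\<psi>s ! l)"
    "\<forall>x\<in>carrier_vec d. poly_fun d \<Lambda> C x = (retraction \<circ> residual_layers \<psi>s \<circ> lift d p) x"
    "(\<Sum>U\<leftarrow>Us. num_nonzero_params U) \<le> card \<Lambda> * ((4 + 2 * c) * (floor_log q (max_exponent d \<Lambda> + 1) + 1)) * (12 * p)"
    "(\<Sum>U\<leftarrow>Us. num_params U) \<le> L * (12 * p)"
proof -
  obtain prog where prog: "\<forall>l\<in>set prog. layer_within (d + 2 + q) l" "length prog \<le> num_layers q d \<Lambda>"
    "length prog \<le> card \<Lambda> * ((4 + 2 * c) * (floor_log q (max_exponent d \<Lambda> + 1) + 1))"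
    "\<And>x. run prog (\<lambda>i. if 1 \<le> i \<and> i \<le> d then x (i - 1) else 0) 0 = (\<Sum>\<alpha>\<in>\<Lambda>. C \<alpha> * (\<Prod>j<d. x j ^ (\<alpha> $ j)))"
    using polynomial_program[OF d q c \<Lambda>, of C] by blast
  define n where "n = L - length prog"
  define ls where "ls = prog @ replicate n zero_layer"
  define Us where "Us = map (layer_cores p) prog @ replicate n (zero_cores p)"
  have p2: "p \<ge> 2" "p > 0" using p by auto
  have len: "length ls = L" "length Us = L" using prog(2) by (simp_all add: ls_def Us_def n_def L)
  have within: "\<forall>l\<in>set ls. layer_within p l" using prog(1) p by (auto simp: ls_def)
  have rep: "tt_represents affine_basis p (layer_ranks p) (Us ! l) (map (layer_map p) ls ! l)" if "l < L" for l
  proof (cases "l < length prog")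
    case True
    then show ?thesis
      using prog(1) p tt_represents_layer[OF p2(1)] len that by (simp add: ls_def Us_def nth_append)
  next
    case False
    then show ?thesis
      using tt_represents_zero_layer[OF p2(1)] len that by (simp add: ls_def Us_def nth_append)
  qed
  have run_zero: "run (replicate n zero_layer) f = f" for n f by (induction n) simp_all
  have par: "num_params U \<le> 12 * p" if U: "U \<in> set Us" for U
  proof -
    obtain l where "l < length Us" "Us ! l = U" using U by (auto simp: in_set_conv_nth)
    with rep[of l] len(2) show ?thesis using num_params_le[OF _ p2(1)] by (simp add: tt_represents_def)
  qed
  show ?thesis
  proof (rule that[of "map (layer_map p) ls" Us])
    show "\<forall>x\<in>carrier_vec d. poly_fun d \<Lambda> C x = (retraction \<circ> residual_layers (map (layer_map p) ls) \<circ> lift d p) x"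
    proof
      fix x :: "real vec" assume "x \<in> carrier_vec d"
      have "residual_layers (map (layer_map p) ls) (lift d p x) =
          vec p (run ls (\<lambda>i. if 1 \<le> i \<and> i \<le> d then x $ (i - 1) else 0))"
        unfolding lift_def by (rule residual_layers_run[OF within p2(2)])
      then show "poly_fun d \<Lambda> C x = (retraction \<circ> residual_layers (map (layer_map p) ls) \<circ> lift d p) x"
        using p2(2) prog(4)[of "($) x"] by (simp add: retraction_def poly_fun_def ls_def run_zero)
    qed
    have "(\<Sum>U\<leftarrow>Us. num_nonzero_params U) = (\<Sum>l\<leftarrow>prog. num_nonzero_params (layer_cores p l))"
      by (simp add: Us_def comp_def num_nonzero_params_zero_cores sum_list_replicate)
    also have "\<dots> \<le> length prog * (12 * p)"
    proof (rule sum_list_le_const)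
      fix l assume "l \<in> set prog"
      then have "num_params (layer_cores p l) \<le> 12 * p" by (intro par) (simp add: Us_def)
      with num_nonzero_params_le[of "layer_cores p l"] show "num_nonzero_params (layer_cores p l) \<le> 12 * p" by linarith
    qed
    also have "\<dots> \<le> card \<Lambda> * ((4 + 2 * c) * (floor_log q (max_exponent d \<Lambda> + 1) + 1)) * (12 * p)"
      using prog(3) by (rule mult_le_mono1)
    finally show "(\<Sum>U\<leftarrow>Us. num_nonzero_params U) \<le> \<dots>" .
    show "(\<Sum>U\<leftarrow>Us. num_params U) \<le> L * (12 * p)"
      using sum_list_le_const[of Us num_params "12 * p"] par len by simp
  qed (use len rep in auto)
qed

text \<open>The \<open>2 + d\<close> layers per monomial are absorbed through
  \<open>2 + d \<le> 3 * d\<close> and \<open>M \<ge> 1\<close>.\<close>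

lemma num_layers_le:
  assumes "d \<ge> 1" "q \<ge> 2" "finite \<Lambda>" "M = floor_log q (max_exponent d \<Lambda> + 1)" "M \<ge> 1"
  shows "num_layers q d \<Lambda> \<le> 4 * (d * card \<Lambda> * M)"
proof -
  have "(\<Sum>\<alpha>\<in>\<Lambda>. \<Sum>j<d. floor_log q (\<alpha> $ j + 1)) \<le> (\<Sum>\<alpha>\<in>\<Lambda>. \<Sum>j<d. M)"
    unfolding assms(4)
    by (intro sum_mono floor_log_mono[OF assms(2)] add_mono exponent_le_max_exponent[OF assms(3)]) auto
  also have "\<dots> = d * card \<Lambda> * M" by simp
  finally have "num_layers q d \<Lambda> \<le> card \<Lambda> * (2 + d) + d * card \<Lambda> * M" by (simp add: num_layers_def)
  also have "card \<Lambda> * (2 + d) \<le> card \<Lambda> * (3 * d)" using assms(1) by (intro mult_left_mono) auto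
  also have "\<dots> \<le> card \<Lambda> * (3 * d) * M" using assms(5) by simp
  finally show ?thesis by (simp add: algebra_simps)
qed

theorem proposition3p5:
  "\<exists>K::real. K > 0 \<and>
    (\<forall>q::nat. q \<ge> 2 \<longrightarrow>
      (\<exists>Kq::real. Kq > 0 \<and>
        (\<forall>(d::nat) (\<Lambda>::nat vec set) (C::nat vec \<Rightarrow> real).
          d \<ge> 1 \<and> finite \<Lambda> \<and> \<Lambda> \<noteq> {} \<and> \<Lambda> \<subseteq> carrier_vec d \<and> (\<forall>\<alpha>\<in>\<Lambda>. C \<alpha> \<noteq> 0) \<longrightarrow>
          (let p = d + 2 + q;
               L = num_layers q d \<Lambda>;
               M = floor_log q (max_exponent d \<Lambda> + 1)
           in
            (\<exists>(\<psi>s :: (real vec \<Rightarrow> real vec) list) (Us :: tt_cores list).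
               length \<psi>s = L \<and> length Us = L \<and>
               (\<forall>l<L. \<exists>r. tt_represents affine_basis p r (Us ! l) (\<psi>s ! l)) \<and>
               (\<forall>x \<in> carrier_vec d.
                  poly_fun d \<Lambda> C x = (retraction \<circ> residual_layers \<psi>s \<circ> lift d p) x) \<and>
               real (\<Sum>U\<leftarrow>Us. num_nonzero_params U)
                 \<le> Kq * (real (card \<Lambda>) * real d * (1 + real M)) \<and>
               real (\<Sum>U\<leftarrow>Us. num_params U) \<le> K * (real L * real (d + q)) \<and>
               (\<forall>l<L. \<forall>k<p. tt_rank affine_basis p (\<psi>s ! l) k \<le> (if k = 0 then p else 2))) \<and>
            (M \<ge> 1 \<longrightarrow> real L \<le> K * (real d * real (card \<Lambda>) * real M))))))"
proof (rule exI[of _ 24], intro conjI allI impI)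
  \<comment> \<open>The constant 24 comes from \<open>12 * p \<le> 24 * (d + q)\<close>; it also
    covers the factor 4 in the bound on the depth.\<close>
  show "(24 :: real) > 0" by simp
  fix q :: nat
  assume q: "q \<ge> 2"
  obtain c where c: "c \<ge> 1" "q \<le> 2 ^ c" "2 ^ (c - 1) < q" using ex_log_ceiling[OF q] by blast
  \<comment> \<open>This is fixed before \<open>d\<close> and \<Lambda>: 12 from the parameters per
    layer, \<open>4 + 2 * c\<close> from the program length, and \<open>q + 3\<close> from
    \<open>p \<le> d * (q + 3)\<close>.\<close>
  define B where "B = 12 * (4 + 2 * c) * (q + 3)"
  show "\<exists>Kq::real. Kq > 0 \<and>
        (\<forall>(d::nat) (\<Lambda>::nat vec set) (C::nat vec \<Rightarrow> real).
          d \<ge> 1 \<and> finite \<Lambda> \<and> \<Lambda> \<noteq> {} \<and> \<Lambda> \<subseteq> carrier_vec d \<and> (\<forall>\<alpha>\<in>\<Lambda>. C \<alpha> \<noteq> 0) \<longrightarrow>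
          (let p = d + 2 + q;
               L = num_layers q d \<Lambda>;
               M = floor_log q (max_exponent d \<Lambda> + 1)
           in
            (\<exists>(\<psi>s :: (real vec \<Rightarrow> real vec) list) (Us :: tt_cores list).
               length \<psi>s = L \<and> length Us = L \<and>
               (\<forall>l<L. \<exists>r. tt_represents affine_basis p r (Us ! l) (\<psi>s ! l)) \<and>
               (\<forall>x \<in> carrier_vec d.
                  poly_fun d \<Lambda> C x = (retraction \<circ> residual_layers \<psi>s \<circ> lift d p) x) \<and>
               real (\<Sum>U\<leftarrow>Us. num_nonzero_params U)
                 \<le> Kq * (real (card \<Lambda>) * real d * (1 + real M)) \<and>
               real (\<Sum>U\<leftarrow>Us. num_params U) \<le> 24 * (real L * real (d + q)) \<and>
               (\<forall>l<L. \<forall>k<p. tt_rank affine_basis p (\<psi>s ! l) k \<le> (if k = 0 then p else 2))) \<and>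
            (M \<ge> 1 \<longrightarrow> real L \<le> 24 * (real d * real (card \<Lambda>) * real M))))"
  proof (rule exI[of _ "real B"], intro conjI allI impI)
    show "real B > 0" by (simp add: B_def)
    fix d :: nat and \<Lambda> :: "nat vec set" and C :: "nat vec \<Rightarrow> real"
    assume "d \<ge> 1 \<and> finite \<Lambda> \<and> \<Lambda> \<noteq> {} \<and> \<Lambda> \<subseteq> carrier_vec d \<and> (\<forall>\<alpha>\<in>\<Lambda>. C \<alpha> \<noteq> 0)"
    then have d: "d \<ge> 1" and \<Lambda>: "finite \<Lambda>" "\<Lambda> \<noteq> {}" by auto
    define p where "p = d + 2 + q"
    define L where "L = num_layers q d \<Lambda>"
    define M where "M = floor_log q (max_exponent d \<Lambda> + 1)"
    obtain \<psi>s Us where enc: "length \<psi>s = L" "length Us = L"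
      "\<forall>l<L. tt_represents affine_basis p (layer_ranks p) (Us ! l) (\<psi>s ! l)"
      "\<forall>x\<in>carrier_vec d. poly_fun d \<Lambda> C x = (retraction \<circ> residual_layers \<psi>s \<circ> lift d p) x"
      "(\<Sum>U\<leftarrow>Us. num_nonzero_params U) \<le> card \<Lambda> * ((4 + 2 * c) * (M + 1)) * (12 * p)"
      "(\<Sum>U\<leftarrow>Us. num_params U) \<le> L * (12 * p)"
      using polynomial_encoding[OF d q c \<Lambda> p_def L_def, of C] unfolding M_def by blast
    have "p \<le> d * (q + 3)" using d mult_le_mono1[OF d, of "q + 2"] by (simp add: p_def algebra_simps)
    then have "card \<Lambda> * ((4 + 2 * c) * (M + 1)) * (12 * p) \<le> card \<Lambda> * ((4 + 2 * c) * (M + 1)) * (12 * (d * (q + 3)))"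
      by (intro mult_left_mono) auto
    also have "\<dots> = B * (card \<Lambda> * d * (1 + M))" by (simp add: B_def algebra_simps)
    finally have "(\<Sum>U\<leftarrow>Us. num_nonzero_params U) \<le> B * (card \<Lambda> * d * (1 + M))" using enc(5) by linarith
    then have nonzero: "real (\<Sum>U\<leftarrow>Us. num_nonzero_params U) \<le> real B * (real (card \<Lambda>) * real d * (1 + real M))"
      by (metis (no_types, opaque_lifting) of_nat_1 of_nat_add of_nat_le_iff of_nat_mult)
    have "L * (12 * p) \<le> L * (24 * (d + q))" using d q by (intro mult_left_mono) (auto simp: p_def)
    then have "(\<Sum>U\<leftarrow>Us. num_params U) \<le> 24 * (L * (d + q))" using enc(6) by (simp add: algebra_simps)
    then have params: "real (\<Sum>U\<leftarrow>Us. num_params U) \<le> 24 * (real L * real (d + q))"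
      by (metis (no_types, opaque_lifting) of_nat_le_iff of_nat_mult of_nat_numeral)
    have ranks: "tt_rank affine_basis p (\<psi>s ! l) k \<le> (if k = 0 then p else 2)" if "l < L" "k < p" for l k
      using tt_rank_le[OF enc(3)[rule_format, OF that(1)], of k] that(2) by (simp add: layer_ranks_def split: if_splits)
    have depth: "real L \<le> 24 * (real d * real (card \<Lambda>) * real M)" if "M \<ge> 1"
    proof -
      have "L \<le> 24 * (d * card \<Lambda> * M)"
        using num_layers_le[OF d q \<Lambda>(1) M_def that] unfolding L_def by linarith
      then show ?thesis by (metis (no_types, opaque_lifting) of_nat_le_iff of_nat_mult of_nat_numeral)
    qed
    show "let p = d + 2 + q;
               L = num_layers q d \<Lambda>;
               M = floor_log q (max_exponent d \<Lambda> + 1)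
           in
            (\<exists>(\<psi>s :: (real vec \<Rightarrow> real vec) list) (Us :: tt_cores list).
               length \<psi>s = L \<and> length Us = L \<and>
               (\<forall>l<L. \<exists>r. tt_represents affine_basis p r (Us ! l) (\<psi>s ! l)) \<and>
               (\<forall>x \<in> carrier_vec d.
                  poly_fun d \<Lambda> C x = (retraction \<circ> residual_layers \<psi>s \<circ> lift d p) x) \<and>
               real (\<Sum>U\<leftarrow>Us. num_nonzero_params U)
                 \<le> real B * (real (card \<Lambda>) * real d * (1 + real M)) \<and>
               real (\<Sum>U\<leftarrow>Us. num_params U) \<le> 24 * (real L * real (d + q)) \<and>
               (\<forall>l<L. \<forall>k<p. tt_rank affine_basis p (\<psi>s ! l) k \<le> (if k = 0 then p else 2))) \<and>
            (M \<ge> 1 \<longrightarrow> real L \<le> 24 * (real d * real (card \<Lambda>) * real M))"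
      unfolding Let_def p_def[symmetric] L_def[symmetric] M_def[symmetric]
    proof (intro conjI impI exI[of _ \<psi>s] exI[of _ Us])
      show "\<forall>l<L. \<exists>r. tt_represents affine_basis p r (Us ! l) (\<psi>s ! l)" using enc(3) by blast
      show "\<forall>l<L. \<forall>k<p. tt_rank affine_basis p (\<psi>s ! l) k \<le> (if k = 0 then p else 2)" using ranks by blast
    qed (use enc nonzero params depth in auto)
  qed
qed

end
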